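(* Let $A$ be finite with $|A|\ge2$, let $Q$ and $H\subseteq A^Q$ be non-empty finite sets, and let $\mathcal F\subseteq\mathcal O(A)$ be a symmetric conservative clone with $\mathrm r(\mathcal F)=2$. Write $\mathrm R^*_2(\mathcal F)=\mathrm R_2(\mathcal F)\cap(A^2_2\times A^2_2)$. (4) If neither (i) $|A|=4$ and $\mathrm R^*_2(\mathcal F)=R_\pm(A)$, nor (ii) $|A|=3$ and $\mathrm R^*_2(\mathcal F)=R_\uparrow(A)$ holds, then $H\in\mathrm{Inv}_Q\mathcal F$ iff (a) $H|_{Q^{[B]}_H}\in\mathrm{Inv}_{Q^{[B]}_H}\mathcal F|_{B^{<\omega}}$ for all $B\in[A]^2$, and (b) $H$ is decomposable over $[Q]^1\cup[Q]^{2,id}_H\cup\{Q^{[B]}_H:B\in[A]^2\}$. (5) If $|A|=4$ and $\mathrm R^*_2(\mathcal F)=R_\pm(A)$, then $H\in\mathrm{Inv}_Q\mathcal F$ iff (a) $H|_P\in\mathrm{Inv}_P\mathcal F$ for all $P\in[Q]^{2,0}_H$, (b) $H|_{Q^{(3)}_H}$ is preserved by all Klein's $\Pi_0(\mathcal F)$-functions, and (c) $H$ is decomposable over $[Q]^1\cup[Q]^{2,0}_H\cup\{Q^{(3)}_H\}$. (6) If $|A|=3$ and $\mathrm R^*_2(\mathcal F)=R_\uparrow(A)$, then $H\in\mathrm{Inv}_Q\mathcal F$ iff (a) $H|_P\in\mathrm{Inv}_P\mathcal F$ for all $P\in[Q]^{2,0}_H\cup[Q]^{2,1}_H$, and (b)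 $H$ is decomposable over $[Q]^1\cup[Q]^{2,0}_H\cup[Q]^{2,1}_H$.
   Context: $\mathcal O(A)=\bigcup_{n<\omega}A^{A^n}$; $\mathcal F_{[n]}=\mathcal F\cap A^{A^n}$; $S_A$ the permutations of $A$; $[X]^k$ the $k$-element subsets of $X$; $A^2_2$ the pairs $\mathbf x=x_0x_1$ with $x_0\ne x_1$, $\mathrm{ran}\,\mathbf x=\{x_0,x_1\}$. A clone with carrier $A$ is a subset of $\mathcal O(A)$ containing all projections and closed under composition; conservative if $f(\mathbf a)\in\mathrm{ran}\,\mathbf a$ for all members $f$; symmetric if for each member $f$ and $\sigma\in S_A$, $f_\sigma(\mathbf a)=\sigma^{-1}(f(\sigma(\mathbf a)))$ is a member. $\mathrm r(\mathcal F)$ is the least $r$ such that $\mathcal F$ has a non-projection $r$-ary member. $\mathrm R_2(\mathcal F)$: $\mathbf a\,\mathrm R_2(\mathcal F)\,\mathbf b$ iff some $\sigma\in S_A$ satisfies $f(\mathbf b)=\sigma(f(\mathbf a))$ for all $f\in\mathcal F_{[2]}$. For $|A|=3$: $R_\uparrow(A)=\{(ab,cd)\in A^2_2\times A^2_2: ab=cd\ \text{or}\ (b=c\wedge a\ne d)\ \text{or}\ (a=d\wedge b\ne c)\}$. For $|A|=4$: $R_\pm(A)=\{(\mathbf x,\mathbf y)\in A^2_2\times A^2_2:\mathrm{ran}\,\mathbf x=\mathrm{ran}\,\mathbf y\ \text{or}\ \mathrm{ran}\,\mathbf x\cap\mathrm{ran}\,\mathbf y=\emptyset\}$. For symmetric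 conservative $\mathcal F$, $\Pi_0(\mathcal F)$ is the clone on $\{0,1\}$ equal to $\{\sigma\circ f|_{B^n}\circ\sigma^{-1}:n<\omega,f\in\mathcal F_{[n]}\}$ for any $B\in[A]^2$ and bijection $\sigma\colon B\to\{0,1\}$ (independent of the choices). For $|A|=4$ and a clone $P$ on $\{0,1\}$, $f\in\mathcal O(A)_{[n]}$ is a Klein's $P$-function if (1) for every $B\in[A]^2$, $f$ maps $B^n$ into $B$ and $\sigma\circ f|_{B^n}\circ\sigma^{-1}\in P$ for a bijection $\sigma\colon B\to\{0,1\}$, and (2) $\sigma(f(\mathbf a))=f(\sigma(\mathbf a))$ for all $\mathbf a\in A^n$ with exactly two distinct entries and all $\sigma$ in the Klein four-group of permutations of $A$ (identity and the three fixed-point-free involutions). For $B\subseteq A$, $\mathcal F|_{B^{<\omega}}=\{f|_{B^n}:f\in\mathcal F_{[n]}\}$. For $f\in\mathcal O(A)_{[m]}$, $h_i\in A^Q$, $f(h_0,\dots,h_{m-1})$ is $q\mapsto f(h_0(q)\dots h_{m-1}(q))$; $f$ preserves $H$ if $H$ is closed under such compositions; $\mathrm{Inv}_Q\mathcal F$ is the set of $H\subseteq A^Q$ preserved by all $f\in\mathcal F$. $H|_P=\{h|_P:h\in H\}$, $H(q)=\{h(q):h\in H\}$. $(H|_R)|^Q=\{f\in A^Q:f|_R\in H|_R\}$; $H$ is decomposable over $\mathscr R$ if $H=\bigcap_{R\in\mathscr R}(H|_R)|^Q$. $[Q]^{2,0}_H$: pairs $\{p,q\}$ with some $\sigma\in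 S_A$ such that $h(q)=\sigma(h(p))$ for all $h\in H$; $[Q]^{2,1}_H$: pairs $\{p,q\}$ with some $a,b\in A$ such that $h(p)=a$ or $h(q)=b$ for every $h\in H$; $[Q]^{2,id}_H$: pairs $\{p,q\}$ with $h(p)=h(q)$ for all $h\in H$; $Q^{(3)}_H=\{q:|H(q)|<3\}$; $Q^{[B]}_H=\{q:H(q)\subseteq B\}$. *)

theory Defs
  imports "HOL-Library.FuncSet" "HOL-Combinatorics.Permutations"
begin

(* n-ary operations on a carrier A are represented by pairs (n, f), where
   f :: 'a list => 'a is an extensional function from A^n (lists of length n
   over A) to A.  A set of such pairs is a subset of O(A). *)

definition tuples :: "'a set \<Rightarrow> nat \<Rightarrow> 'a list set" where
  "tuples A n = {xs. length xs = n \<and> set xs \<subseteq> A}"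

definition ops :: "'a set \<Rightarrow> (nat \<times> ('a list \<Rightarrow> 'a)) set" where
  "ops A = {(n, f). f \<in> tuples A n \<rightarrow>\<^sub>E A}"

definition proj :: "'a set \<Rightarrow> nat \<Rightarrow> nat \<Rightarrow> 'a list \<Rightarrow> 'a" where
  "proj A n i = restrict (\<lambda>xs. xs ! i) (tuples A n)"

definition is_proj :: "'a set \<Rightarrow> nat \<Rightarrow> ('a list \<Rightarrow> 'a) \<Rightarrow> bool" where
  "is_proj A n f \<longleftrightarrow> (\<exists>i<n. f = proj A n i)"

definition clone :: "'a set \<Rightarrow> (nat \<times> ('a list \<Rightarrow> 'a)) set \<Rightarrow> bool" where
  "clone A F \<longleftrightarrow> F \<subseteq> ops A
     \<and> (\<forall>n i. i < n \<longrightarrow> (n, proj A n i) \<in> F)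
     \<and> (\<forall>m n f gs. (m, f) \<in> F \<longrightarrow> length gs = m \<longrightarrow> (\<forall>g\<in>set gs. (n, g) \<in> F)
          \<longrightarrow> (n, restrict (\<lambda>xs. f (map (\<lambda>g. g xs) gs)) (tuples A n)) \<in> F)"

definition conservative :: "'a set \<Rightarrow> (nat \<times> ('a list \<Rightarrow> 'a)) set \<Rightarrow> bool" where
  "conservative A F \<longleftrightarrow> (\<forall>(n, f) \<in> F. \<forall>xs \<in> tuples A n. f xs \<in> set xs)"

definition conj_op :: "'a set \<Rightarrow> ('a \<Rightarrow> 'a) \<Rightarrow> nat \<Rightarrow> ('a list \<Rightarrow> 'a) \<Rightarrow> 'a list \<Rightarrow> 'a" where
  "conj_op A \<sigma> n f = restrict (\<lambda>xs. inv \<sigma> (f (map \<sigma> xs))) (tuples A n)"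

definition symmetric_ops :: "'a set \<Rightarrow> (nat \<times> ('a list \<Rightarrow> 'a)) set \<Rightarrow> bool" where
  "symmetric_ops A F \<longleftrightarrow> (\<forall>(n, f) \<in> F. \<forall>\<sigma>. \<sigma> permutes A \<longrightarrow> (n, conj_op A \<sigma> n f) \<in> F)"

(* r(F): least r such that F has a non-projection r-ary member (0 if there is none,
   which is irrelevant since only r(F) = 2 is used) *)
definition clone_rank :: "'a set \<Rightarrow> (nat \<times> ('a list \<Rightarrow> 'a)) set \<Rightarrow> nat" where
  "clone_rank A F = (if \<exists>r f. (r, f) \<in> F \<and> \<not> is_proj A r f
      then (LEAST r. \<exists>f. (r, f) \<in> F \<and> \<not> is_proj A r f) else 0)"

definition A22 :: "'a set \<Rightarrow> ('a \<times> 'a) set" where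
  "A22 A = {(x0, x1). x0 \<in> A \<and> x1 \<in> A \<and> x0 \<noteq> x1}"

definition R2 :: "'a set \<Rightarrow> (nat \<times> ('a list \<Rightarrow> 'a)) set \<Rightarrow> (('a \<times> 'a) \<times> ('a \<times> 'a)) set" where
  "R2 A F = {((a0, a1), (b0, b1)). a0 \<in> A \<and> a1 \<in> A \<and> b0 \<in> A \<and> b1 \<in> A \<and>
      (\<exists>\<sigma>. \<sigma> permutes A \<and> (\<forall>f. (2, f) \<in> F \<longrightarrow> f [b0, b1] = \<sigma> (f [a0, a1])))}"

definition R2star :: "'a set \<Rightarrow> (nat \<times> ('a list \<Rightarrow> 'a)) set \<Rightarrow> (('a \<times> 'a) \<times> ('a \<times> 'a)) set" where
  "R2star A F = R2 A F \<inter> (A22 A \<times> A22 A)"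

definition R_up :: "'a set \<Rightarrow> (('a \<times> 'a) \<times> ('a \<times> 'a)) set" where
  "R_up A = {((a, b), (c, d)). (a, b) \<in> A22 A \<and> (c, d) \<in> A22 A \<and>
      ((a, b) = (c, d) \<or> (b = c \<and> a \<noteq> d) \<or> (a = d \<and> b \<noteq> c))}"

definition R_pm :: "'a set \<Rightarrow> (('a \<times> 'a) \<times> ('a \<times> 'a)) set" where
  "R_pm A = {((x0, x1), (y0, y1)). (x0, x1) \<in> A22 A \<and> (y0, y1) \<in> A22 A \<and>
      ({x0, x1} = {y0, y1} \<or> {x0, x1} \<inter> {y0, y1} = {})}"

definition ksubsets :: "'a set \<Rightarrow> nat \<Rightarrow> 'a set set" where
  "ksubsets X k = {B. B \<subseteq> X \<and> finite B \<and> card B = k}"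

definition transport2 :: "'a set \<Rightarrow> ('a \<Rightarrow> nat) \<Rightarrow> nat \<Rightarrow> ('a list \<Rightarrow> 'a) \<Rightarrow> nat list \<Rightarrow> nat" where
  "transport2 B \<sigma> n f = restrict (\<lambda>xs. \<sigma> (f (map (inv_into B \<sigma>) xs))) (tuples {0, 1} n)"

(* Pi_0(F): union over all choices of B and sigma (the choices do not matter) *)
definition Pi0 :: "'a set \<Rightarrow> (nat \<times> ('a list \<Rightarrow> 'a)) set \<Rightarrow> (nat \<times> (nat list \<Rightarrow> nat)) set" where
  "Pi0 A F = {(n, transport2 B \<sigma> n f) | n f B \<sigma>.
      (n, f) \<in> F \<and> B \<in> ksubsets A 2 \<and> bij_betw \<sigma> B {0, 1}}"

definition klein_group :: "'a set \<Rightarrow> ('a \<Rightarrow> 'a) set" where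
  "klein_group A = {\<sigma>. \<sigma> permutes A \<and>
      (\<sigma> = id \<or> (\<forall>x\<in>A. \<sigma> x \<noteq> x \<and> \<sigma> (\<sigma> x) = x))}"

definition klein_fun :: "'a set \<Rightarrow> (nat \<times> (nat list \<Rightarrow> nat)) set \<Rightarrow> nat \<Rightarrow> ('a list \<Rightarrow> 'a) \<Rightarrow> bool" where
  "klein_fun A P n f \<longleftrightarrow> (n, f) \<in> ops A
     \<and> (\<forall>B \<in> ksubsets A 2. (\<forall>xs \<in> tuples B n. f xs \<in> B) \<and>
          (\<exists>\<sigma>. bij_betw \<sigma> B {0, 1} \<and> (n, transport2 B \<sigma> n f) \<in> P))
     \<and> (\<forall>xs \<in> tuples A n. card (set xs) = 2 \<longrightarrow>
          (\<forall>\<sigma> \<in> klein_group A. \<sigma> (f xs) = f (map \<sigma> xs)))"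

definition restrict_ops :: "'a set \<Rightarrow> (nat \<times> ('a list \<Rightarrow> 'a)) set \<Rightarrow> (nat \<times> ('a list \<Rightarrow> 'a)) set" where
  "restrict_ops B F = {(n, restrict f (tuples B n)) | n f. (n, f) \<in> F}"

definition preserves :: "'q set \<Rightarrow> nat \<Rightarrow> ('a list \<Rightarrow> 'a) \<Rightarrow> ('q \<Rightarrow> 'a) set \<Rightarrow> bool" where
  "preserves Q m f H \<longleftrightarrow> (\<forall>hs. length hs = m \<longrightarrow> set hs \<subseteq> H \<longrightarrow>
      restrict (\<lambda>q. f (map (\<lambda>h. h q) hs)) Q \<in> H)"

definition Inv :: "'a set \<Rightarrow> 'q set \<Rightarrow> (nat \<times> ('a list \<Rightarrow> 'a)) set \<Rightarrow> ('q \<Rightarrow> 'a) set set" where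
  "Inv A Q F = {H. H \<subseteq> Q \<rightarrow>\<^sub>E A \<and> (\<forall>(m, f) \<in> F. preserves Q m f H)}"

definition restr :: "('q \<Rightarrow> 'a) set \<Rightarrow> 'q set \<Rightarrow> ('q \<Rightarrow> 'a) set" where
  "restr H P = (\<lambda>h. restrict h P) ` H"

definition lift :: "'a set \<Rightarrow> 'q set \<Rightarrow> ('q \<Rightarrow> 'a) set \<Rightarrow> 'q set \<Rightarrow> ('q \<Rightarrow> 'a) set" where
  "lift A Q H R = {f \<in> Q \<rightarrow>\<^sub>E A. restrict f R \<in> restr H R}"

definition decomposable :: "'a set \<Rightarrow> 'q set \<Rightarrow> ('q \<Rightarrow> 'a) set \<Rightarrow> 'q set set \<Rightarrow> bool" where
  "decomposable A Q H \<R> \<longleftrightarrow> H = (\<Inter>R \<in> \<R>. lift A Q H R)"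

definition Hq :: "('q \<Rightarrow> 'a) set \<Rightarrow> 'q \<Rightarrow> 'a set" where
  "Hq H q = (\<lambda>h. h q) ` H"

definition pairs0 :: "'a set \<Rightarrow> 'q set \<Rightarrow> ('q \<Rightarrow> 'a) set \<Rightarrow> 'q set set" where
  "pairs0 A Q H = {{p, q} | p q. p \<in> Q \<and> q \<in> Q \<and> p \<noteq> q \<and>
      (\<exists>\<sigma>. \<sigma> permutes A \<and> (\<forall>h\<in>H. h q = \<sigma> (h p)))}"

definition pairs1 :: "'a set \<Rightarrow> 'q set \<Rightarrow> ('q \<Rightarrow> 'a) set \<Rightarrow> 'q set set" where
  "pairs1 A Q H = {{p, q} | p q. p \<in> Q \<and> q \<in> Q \<and> p \<noteq> q \<and>
      (\<exists>a\<in>A. \<exists>b\<in>A. \<forall>h\<in>H. h p = a \<or> h q = b)}"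

definition pairs_id :: "'q set \<Rightarrow> ('q \<Rightarrow> 'a) set \<Rightarrow> 'q set set" where
  "pairs_id Q H = {{p, q} | p q. p \<in> Q \<and> q \<in> Q \<and> p \<noteq> q \<and> (\<forall>h\<in>H. h p = h q)}"

definition singletons :: "'q set \<Rightarrow> 'q set set" where
  "singletons Q = {{q} | q. q \<in> Q}"

definition Q3 :: "'q set \<Rightarrow> ('q \<Rightarrow> 'a) set \<Rightarrow> 'q set" where
  "Q3 Q H = {q \<in> Q. card (Hq H q) < 3}"

definition QB :: "'q set \<Rightarrow> ('q \<Rightarrow> 'a) set \<Rightarrow> 'a set \<Rightarrow> 'q set" where
  "QB Q H B = {q \<in> Q. Hq H q \<subseteq> B}"

end

(* The binary members of a symmetric conservative clone, regarded as choices between the entries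
   of pairs x0 x1 with x0 \<noteq> x1, form a lattice of subsets of A22 A.  Invariance under the
   symmetric group makes the associated preorder an equivalence relation, namely R2star A F, so that
   every set saturated under it is realised by a binary member; only equality, "same range", R_pm
   and R_up (and the excluded total relation) can occur.

   Decomposability of an invariant H: take a minimal set P of coordinates on which some locally
   matched h is not matched by H.  For each q in P some member of H agrees with h on P except at q.
   Applying binary members to two such functions forces their deviations from h to be equivalent.
   In the exceptional cases A is identified with Z3, respectively Z2 x Z2, such that the
   equivalence becomes equality of differences; after translating h to 0 this forces P to be a pair
   in pairs0 or pairs1.

   A Klein function agrees with a member of F on all tuples with at most two entries: for each of the
   three partitions of A into pairs there is such a member for that partition, and binary members
   select between the three. *)

theory Submission
  imports Defs "HOL-Library.Numeral_Type" "HOL-Library.Z2" "HOL-Library.Product_Plus"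
begin

section \<open>Local agreement\<close>

text \<open>Decomposability draws only on the binary members; higher arities enter through closure
  on the individual pieces, where conservativity alone settles single coordinates and coordinates
  that \<open>H\<close> identifies. The shape of the pieces is dictated by how near misses deviate
  from \<open>h\<close>. Over Z3 the deviations at two coordinates are opposite, and a group of odd
  order has no three pairwise opposite nonzero elements, so pairs suffice. In the generic case and
  over Z2 x Z2 the relation between deviations is symmetric. If all values at each coordinate of the
  set lie in one pair, selecting between \<open>k\<close> and \<open>l\<close> by ranges or
  differences returns \<open>k\<close> or \<open>l\<close> unchanged and gives no information; this
  is why a whole block \<open>QB Q H B\<close> or \<open>Q3 Q H\<close> has to be kept. A further
  value is the lever: two selections confine it to exactly two coordinates, and one more selection
  shows that no other coordinate exists.\<close>

definition agrees_on :: "('q \<Rightarrow> 'a) set \<Rightarrow> ('q \<Rightarrow> 'a) \<Rightarrow> 'q set \<Rightarrow> bool" where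
  "agrees_on H h P \<longleftrightarrow> (\<exists>k\<in>H. \<forall>q\<in>P. k q = h q)"

lemma agrees_on_mono: "agrees_on H h P \<Longrightarrow> R \<subseteq> P \<Longrightarrow> agrees_on H h R"
  by (auto simp: agrees_on_def)

lemma restrict_in_restr_iff: "restrict h P \<in> restr H P \<longleftrightarrow> agrees_on H h P"
proof -
  have "restrict h P = restrict k P \<longleftrightarrow> (\<forall>q\<in>P. k q = h q)" for k
    by (auto simp: restrict_def fun_eq_iff)
  then show ?thesis
    by (auto simp: restr_def agrees_on_def)
qed

lemma agrees_on_whole:
  assumes "H \<subseteq> Q \<rightarrow>\<^sub>E A" "h \<in> Q \<rightarrow>\<^sub>E A"
  shows "agrees_on H h Q \<longleftrightarrow> h \<in> H"
proof
  assume "agrees_on H h Q"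
  then obtain k where "k \<in> H" "\<forall>q\<in>Q. k q = h q"
    unfolding agrees_on_def by blast
  moreover from this have "k = h"
    using assms by (intro PiE_ext[of k Q "\<lambda>_. A" h]) auto
  ultimately show "h \<in> H"
    by simp
qed (auto simp: agrees_on_def)

text \<open>Members of \<open>H\<close> are matched everywhere, so only the inclusion into
  \<open>H\<close> carries content. An empty family would have the whole type as its intersection,
  including functions outside \<open>Q \<rightarrow>\<^sub>E A\<close>.\<close>

lemma decomposable_iff:
  assumes "H \<subseteq> Q \<rightarrow>\<^sub>E A" "\<R> \<noteq> {}"
  shows "decomposable A Q H \<R> \<longleftrightarrow>
    (\<forall>h \<in> Q \<rightarrow>\<^sub>E A. (\<forall>R\<in>\<R>. agrees_on H h R) \<longrightarrow> h \<in> H)"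
proof -
  have "(\<Inter>R\<in>\<R>. lift A Q H R) = {h \<in> Q \<rightarrow>\<^sub>E A. \<forall>R\<in>\<R>. agrees_on H h R}"
    using assms(2) by (auto simp: lift_def restrict_in_restr_iff)
  moreover have "H \<subseteq> {h \<in> Q \<rightarrow>\<^sub>E A. \<forall>R\<in>\<R>. agrees_on H h R}"
    using assms(1) by (auto simp: agrees_on_def)
  ultimately show ?thesis
    unfolding decomposable_def by blast
qed

section \<open>Closure under the clone on a set of coordinates\<close>

text \<open>Results are compared with members of \<open>H\<close> by agreement only, so one notion
  covers invariance of \<open>H\<close>, of its restriction to a piece, and of a restriction with
  smaller carrier.\<close>

definition closed_on :: "(nat \<times> ('a list \<Rightarrow> 'a)) set \<Rightarrow> ('q \<Rightarrow> 'a) set \<Rightarrow> 'q set \<Rightarrow> bool" where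
  "closed_on F H P \<longleftrightarrow> (\<forall>f hs. (length hs, f) \<in> F \<longrightarrow> set hs \<subseteq> H
    \<longrightarrow> agrees_on H (\<lambda>q. f (map (\<lambda>h. h q) hs)) P)"

lemma closed_on_mono: "closed_on F H Q \<Longrightarrow> R \<subseteq> Q \<Longrightarrow> closed_on F H R"
  unfolding closed_on_def using agrees_on_mono by blast

lemma preserves_restr_iff:
  "preserves P m f (restr H P) \<longleftrightarrow>
    (\<forall>hs. length hs = m \<longrightarrow> set hs \<subseteq> H \<longrightarrow> agrees_on H (\<lambda>q. f (map (\<lambda>h. h q) hs)) P)"
proof (intro iffI allI impI)
  fix hs :: "('a \<Rightarrow> 'b) list"
  assume L: "preserves P m f (restr H P)" and hs: "length hs = m" "set hs \<subseteq> H"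
  let ?hs = "map (\<lambda>h. restrict h P) hs"
  have "length ?hs = m" "set ?hs \<subseteq> restr H P"
    using hs by (auto simp: restr_def)
  then have "restrict (\<lambda>q. f (map (\<lambda>h. h q) ?hs)) P \<in> restr H P"
    using L unfolding preserves_def by blast
  then have "agrees_on H (\<lambda>q. f (map (\<lambda>h. h q) ?hs)) P"
    by (simp only: restrict_in_restr_iff)
  then show "agrees_on H (\<lambda>q. f (map (\<lambda>h. h q) hs)) P"
    by (auto simp: agrees_on_def comp_def)
next
  assume R: "\<forall>hs. length hs = m \<longrightarrow> set hs \<subseteq> H
    \<longrightarrow> agrees_on H (\<lambda>q. f (map (\<lambda>h. h q) hs)) P"
  show "preserves P m f (restr H P)"
    unfolding preserves_def
  proof (intro allI impI)
    fix hs assume hs: "length hs = m" "set hs \<subseteq> restr H P"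
    \<comment> \<open>Each restricted function is replaced by a preimage in \<open>H\<close>; the
      two coincide on \<open>P\<close>, so the operation yields the same values there.\<close>
    then have "\<forall>k\<in>set hs. \<exists>h. h \<in> H \<and> k = restrict h P"
      by (auto simp: restr_def)
    then obtain e where e: "\<forall>k\<in>set hs. e k \<in> H \<and> k = restrict (e k) P"
      by metis
    have "agrees_on H (\<lambda>q. f (map (\<lambda>h. h q) (map e hs))) P"
      using R[rule_format, of "map e hs"] hs e by auto
    moreover have "map (\<lambda>h. h q) (map e hs) = map (\<lambda>h. h q) hs" if "q \<in> P" for q
    proof -
      have "e k q = k q" if "k \<in> set hs" for k
        using e that \<open>q \<in> P\<close> restrict_apply'[of q P "e k"] by auto
      then show ?thesis
        by simp
    qed
    ultimately have "agrees_on H (\<lambda>q. f (map (\<lambda>h. h q) hs)) P"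
      by (simp add: agrees_on_def del: map_map)
    then show "restrict (\<lambda>q. f (map (\<lambda>h. h q) hs)) P \<in> restr H P"
      by (simp only: restrict_in_restr_iff)
  qed
qed

lemma restr_whole:
  assumes "H \<subseteq> Q \<rightarrow>\<^sub>E A"
  shows "restr H Q = H"
proof -
  have "restrict h Q = h" if "h \<in> H" for h
    using subsetD[OF assms that] by (rule PiE_restrict)
  then show ?thesis
    by (simp add: restr_def)
qed

lemma in_Inv_iff:
  assumes "H \<subseteq> Q \<rightarrow>\<^sub>E A"
  shows "H \<in> Inv A Q F \<longleftrightarrow> closed_on F H Q"
  using preserves_restr_iff[of Q _ _ H] assms by (auto simp: Inv_def restr_whole closed_on_def)

lemma restr_in_Inv_iff:
  assumes "H \<subseteq> Q \<rightarrow>\<^sub>E A" "P \<subseteq> Q"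
  shows "restr H P \<in> Inv A P F \<longleftrightarrow> closed_on F H P"
proof -
  have "restrict h P \<in> P \<rightarrow>\<^sub>E A" if "h \<in> H" for h
    unfolding restrict_PiE_iff using subsetD[OF assms(1) that] assms(2) by (auto intro: PiE_mem)
  then have "restr H P \<subseteq> P \<rightarrow>\<^sub>E A"
    unfolding restr_def by blast
  then show ?thesis
    by (auto simp: Inv_def preserves_restr_iff closed_on_def)
qed

lemma QB_subset: "QB Q H B \<subseteq> Q"
  by (auto simp: QB_def)

lemma in_QB_D: "q \<in> QB Q H B \<Longrightarrow> h \<in> H \<Longrightarrow> h q \<in> B"
  by (auto simp: QB_def Hq_def)

lemma Ball_restrict_ops:
  "(\<forall>(m, f)\<in>restrict_ops B F. \<Phi> m f) \<longleftrightarrow>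
    (\<forall>(m, f)\<in>F. \<Phi> m (restrict f (tuples B m)))"
  unfolding restrict_ops_def by blast

text \<open>All members of \<open>H\<close> take values in \<open>B\<close> on these coordinates, so
  every argument tuple lies over \<open>B\<close> and cutting the operations down to
  \<open>B\<close> changes none of the values used.\<close>

lemma restr_QB_in_Inv_iff:
  "restr H (QB Q H B) \<in> Inv B (QB Q H B) (restrict_ops B F) \<longleftrightarrow>
    closed_on F H (QB Q H B)"
proof -
  have "restrict h (QB Q H B) \<in> QB Q H B \<rightarrow>\<^sub>E B" if "h \<in> H" for h
    using in_QB_D[OF _ that] by simp
  then have "restr H (QB Q H B) \<subseteq> QB Q H B \<rightarrow>\<^sub>E B"
    unfolding restr_def by blast
  then have "restr H (QB Q H B) \<in> Inv B (QB Q H B) (restrict_ops B F) \<longleftrightarrow>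
      (\<forall>(m, f)\<in>F. \<forall>hs. length hs = m \<longrightarrow> set hs \<subseteq> H
        \<longrightarrow> agrees_on H (\<lambda>q. restrict f (tuples B m) (map (\<lambda>h. h q) hs)) (QB Q H B))"
    unfolding Inv_def preserves_restr_iff mem_Collect_eq Ball_restrict_ops by simp
  moreover have "agrees_on H (\<lambda>q. restrict f (tuples B m) (map (\<lambda>h. h q) hs)) (QB Q H B)
      \<longleftrightarrow> agrees_on H (\<lambda>q. f (map (\<lambda>h. h q) hs)) (QB Q H B)"
    if "length hs = m" "set hs \<subseteq> H" for m f hs
  proof -
    have "map (\<lambda>h. h q) hs \<in> tuples B m" if "q \<in> QB Q H B" for q
      using \<open>length hs = m\<close> \<open>set hs \<subseteq> H\<close> in_QB_D[OF that] by (auto simp: tuples_def)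
    then show ?thesis
      by (simp add: agrees_on_def)
  qed
  ultimately show ?thesis
    by (auto simp: closed_on_def)
qed

text \<open>Minimality supplies the near misses: dropping any one coordinate restores agreement. The
  empty set is always matched, since \<open>H\<close> has a member, so \<open>P\<close> cannot be
  empty.\<close>

lemma ex_minimal_disagreement:
  assumes "finite Q" "H \<noteq> {}" "\<not> agrees_on H h Q"
  shows "\<exists>P\<subseteq>Q. P \<noteq> {} \<and> \<not> agrees_on H h P \<and> (\<forall>q\<in>P. agrees_on H h (P - {q}))"
proof -
  let ?\<P> = "{P. P \<subseteq> Q \<and> \<not> agrees_on H h P}"
  have "finite ?\<P>" "Q \<in> ?\<P>"
    using assms by auto
  then obtain P where P: "P \<subseteq> Q" "\<not> agrees_on H h P"
    and min: "\<And>R. R \<in> ?\<P> \<Longrightarrow> R \<subseteq> P \<Longrightarrow> P = R"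
    using finite_has_minimal2[of ?\<P> Q] by auto
  have "agrees_on H h (P - {q})" if "q \<in> P" for q
  proof (rule ccontr)
    assume "\<not> agrees_on H h (P - {q})"
    then have "P = P - {q}"
      using P by (intro min) auto
    then show False
      using that by blast
  qed
  moreover have "P \<noteq> {}"
    using P assms(2) by (auto simp: agrees_on_def)
  ultimately show ?thesis
    using P by blast
qed

section \<open>Binary members of a symmetric conservative clone\<close>

text \<open>In a finite \<open>A\<close> the complements of \<open>S\<close> and of its image have
  equal size; any bijection between them completes \<open>f\<close>.\<close>

lemma ex_permutes_extending:
  assumes "finite A" "S \<subseteq> A" "f ` S \<subseteq> A" "inj_on f S"
  shows "\<exists>\<sigma>. \<sigma> permutes A \<and> (\<forall>x\<in>S. \<sigma> x = f x)"
proof -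
  have "card (A - S) = card (A - f ` S)"
    using assms by (simp add: card_Diff_subset card_image finite_subset)
  then obtain g where g: "bij_betw g (A - S) (A - f ` S)"
    using assms(1) finite_same_card_bij by (metis finite_Diff)
  define \<sigma> where "\<sigma> x = (if x \<in> A then if x \<in> S then f x else g x else x)" for x
  have "bij_betw \<sigma> (S \<union> (A - S)) (f ` S \<union> (A - f ` S))"
  proof (rule bij_betw_combine)
    show "bij_betw \<sigma> S (f ` S)"
      using assms by (auto simp: \<sigma>_def bij_betw_def inj_on_def image_def subset_iff)
    show "bij_betw \<sigma> (A - S) (A - f ` S)"
      using g bij_betw_cong[of "A - S" \<sigma> g] by (auto simp: \<sigma>_def)
  qed auto
  then have "bij_betw \<sigma> A A"
    using assms(2,3) by (simp add: Un_absorb1)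
  then have "\<sigma> permutes A"
    by (rule bij_imp_permutes) (simp add: \<sigma>_def)
  moreover have "\<forall>x\<in>S. \<sigma> x = f x"
    using assms(2) by (auto simp: \<sigma>_def)
  ultimately show ?thesis
    by blast
qed

lemma tuples_mono: "B \<subseteq> A \<Longrightarrow> tuples B n \<subseteq> tuples A n"
  by (auto simp: tuples_def)

locale sym_cons_clone =
  fixes A :: "'a set" and F :: "(nat \<times> ('a list \<Rightarrow> 'a)) set"
  assumes fin: "finite A" and clone: "clone A F"
    and cons: "conservative A F" and sym: "symmetric_ops A F"
begin

lemma cons_op: "(n, f) \<in> F \<Longrightarrow> xs \<in> tuples A n \<Longrightarrow> f xs \<in> set xs"
  using cons by (auto simp: conservative_def)

lemma binary_op_cases:
  "(2, f) \<in> F \<Longrightarrow> x \<in> A \<Longrightarrow> y \<in> A \<Longrightarrow> f [x, y] = x \<or> f [x, y] = y"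
  using cons_op[of 2 f "[x, y]"] by (auto simp: tuples_def)

lemma comp_op:
  assumes "(m, f) \<in> F" "length gs = m" "\<forall>g\<in>set gs. (n, g) \<in> F"
  shows "(n, restrict (\<lambda>xs. f (map (\<lambda>g. g xs) gs)) (tuples A n)) \<in> F"
  using clone assms unfolding clone_def by blast

lemma comp_binary:
  assumes "(2, f) \<in> F" "(n, g) \<in> F" "(n, h) \<in> F"
  obtains k where "(n, k) \<in> F" "\<And>xs. xs \<in> tuples A n \<Longrightarrow> k xs = f [g xs, h xs]"
proof
  show "(n, restrict (\<lambda>xs. f (map (\<lambda>g. g xs) [g, h])) (tuples A n)) \<in> F"
    using comp_op[of 2 f "[g, h]"] assms by simp
qed simp

lemma proj_op: "i < n \<Longrightarrow> (n, proj A n i) \<in> F"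
  using clone by (auto simp: clone_def)

lemma comp_binary2:
  assumes "(2, f) \<in> F" "(2, g) \<in> F" "(2, h) \<in> F"
  obtains k where "(2, k) \<in> F"
    "\<And>x y. x \<in> A \<Longrightarrow> y \<in> A \<Longrightarrow> k [x, y] = f [g [x, y], h [x, y]]"
proof -
  obtain k where "(2, k) \<in> F" "\<And>xs. xs \<in> tuples A 2 \<Longrightarrow> k xs = f [g xs, h xs]"
    using comp_binary[OF assms] by blast
  then show ?thesis
    using that by (auto simp: tuples_def)
qed

lemma fst_op: obtains f where "(2, f) \<in> F" "\<And>x y. x \<in> A \<Longrightarrow> y \<in> A \<Longrightarrow> f [x, y] = x"
  by (rule that[of "proj A 2 0"]) (auto simp: proj_op, simp add: proj_def tuples_def)

lemma snd_op: obtains f where "(2, f) \<in> F" "\<And>x y. x \<in> A \<Longrightarrow> y \<in> A \<Longrightarrow> f [x, y] = y"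
  by (rule that[of "proj A 2 1"]) (auto simp: proj_op, simp add: proj_def tuples_def)

lemma swap_op:
  assumes "(2, f) \<in> F"
  obtains g where "(2, g) \<in> F" "\<And>x y. x \<in> A \<Longrightarrow> y \<in> A \<Longrightarrow> g [x, y] = f [y, x]"
proof -
  obtain p where p: "(2, p) \<in> F" "\<And>x y. x \<in> A \<Longrightarrow> y \<in> A \<Longrightarrow> p [x, y] = x"
    using fst_op by blast
  obtain q where q: "(2, q) \<in> F" "\<And>x y. x \<in> A \<Longrightarrow> y \<in> A \<Longrightarrow> q [x, y] = y"
    using snd_op by blast
  obtain g where "(2, g) \<in> F"
    "\<And>x y. x \<in> A \<Longrightarrow> y \<in> A \<Longrightarrow> g [x, y] = f [q [x, y], p [x, y]]"
    using comp_binary2[OF assms q(1) p(1)] by blast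
  then show ?thesis
    using that p q by auto
qed

lemma conj_op_apply:
  assumes "(n, f) \<in> F" "\<sigma> permutes A"
  obtains g where "(n, g) \<in> F"
    "\<And>xs. xs \<in> tuples A n \<Longrightarrow> f (map \<sigma> xs) = \<sigma> (g xs)"
proof
  show "(n, conj_op A \<sigma> n f) \<in> F"
    using sym assms by (auto simp: symmetric_ops_def)
qed (use assms(2) in \<open>simp add: conj_op_def permutes_inverses(1)\<close>)

section \<open>The preorder on pairs and its identification with R2star\<close>

text \<open>Identify a binary member with the set of pairs at which it returns the first entry, its
  first-choice set. This is then the specialization preorder of the family of first-choice
  sets.\<close>

definition le :: "'a \<times> 'a \<Rightarrow> 'a \<times> 'a \<Rightarrow> bool" where
  "le x y \<longleftrightarrow> (\<forall>f. (2, f) \<in> F \<longrightarrow> f [fst x, snd x] = fst x \<longrightarrow> f [fst y, snd y] = fst y)"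

lemma le_refl: "le x x"
  by (simp add: le_def)

lemma le_trans: "le x y \<Longrightarrow> le y z \<Longrightarrow> le x z"
  by (simp add: le_def)

lemma A22_iff: "(a, b) \<in> A22 A \<longleftrightarrow> a \<in> A \<and> b \<in> A \<and> a \<noteq> b"
  by (auto simp: A22_def)

text \<open>The conjugate of \<open>f\<close> by \<open>\<sigma>\<close> chooses at a pair the
  position that \<open>f\<close> chooses at the image pair, and symmetry keeps it in the
  clone.\<close>

lemma le_permute:
  assumes \<sigma>: "\<sigma> permutes A" and xy: "x \<in> A22 A" "y \<in> A22 A" and le: "le x y"
  shows "le (map_prod \<sigma> \<sigma> x) (map_prod \<sigma> \<sigma> y)"
  unfolding le_def
proof (intro allI impI)
  fix f assume f: "(2, f) \<in> F"
    "f [fst (map_prod \<sigma> \<sigma> x), snd (map_prod \<sigma> \<sigma> x)] = fst (map_prod \<sigma> \<sigma> x)"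
  obtain g where g: "(2, g) \<in> F" "\<And>xs. xs \<in> tuples A 2 \<Longrightarrow> f (map \<sigma> xs) = \<sigma> (g xs)"
    using conj_op_apply[OF f(1) \<sigma>] by blast
  have eq: "f [\<sigma> a, \<sigma> b] = \<sigma> (g [a, b])" if "a \<in> A" "b \<in> A" for a b
    using g(2)[of "[a, b]"] that by (simp add: tuples_def)
  have mem: "fst x \<in> A" "snd x \<in> A" "fst y \<in> A" "snd y \<in> A"
    using xy by (auto simp: A22_def)
  have "\<sigma> (g [fst x, snd x]) = \<sigma> (fst x)"
    using f(2) eq mem by simp
  then have "g [fst x, snd x] = fst x"
    using permutes_inj[OF \<sigma>] by (simp add: inj_eq)
  then have "g [fst y, snd y] = fst y"
    using le g(1) by (simp add: le_def)
  then show "f [fst (map_prod \<sigma> \<sigma> y), snd (map_prod \<sigma> \<sigma> y)] = fst (map_prod \<sigma> \<sigma> y)"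
    using eq mem by simp
qed

lemma A22_permute: "\<sigma> permutes A \<Longrightarrow> z \<in> A22 A \<Longrightarrow> map_prod \<sigma> \<sigma> z \<in> A22 A"
  using permutes_inj[of \<sigma> A] permutes_in_image[of \<sigma> A] by (cases z) (simp add: A22_iff inj_eq)

lemma ex_permutes_pair:
  assumes "(a, b) \<in> A22 A" "(c, d) \<in> A22 A"
  obtains \<sigma> where "\<sigma> permutes A" "\<sigma> a = c" "\<sigma> b = d"
proof -
  have "\<exists>\<sigma>. \<sigma> permutes A \<and> (\<forall>x\<in>{a, b}. \<sigma> x = (if x = a then c else d))"
    by (rule ex_permutes_extending) (use assms fin in \<open>auto simp: A22_iff inj_on_def\<close>)
  then show ?thesis
    using that assms by (auto simp: A22_iff)
qed

text \<open>All up-sets of single pairs have the same cardinality, by transitivity of the symmetric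
  group, so the invariant preorder \<^term>\<open>le\<close> is symmetric.\<close>

lemma le_sym:
  assumes xy: "x \<in> A22 A" "y \<in> A22 A" and le: "le x y"
  shows "le y x"
proof -
  define U where "U x = {z \<in> A22 A. le x z}" for x
  have fin_A22: "finite (A22 A)"
    by (rule finite_subset[of _ "A \<times> A"]) (auto simp: A22_def fin)
  obtain \<sigma> where \<sigma>: "\<sigma> permutes A" "\<sigma> (fst x) = fst y" "\<sigma> (snd x) = snd y"
    using ex_permutes_pair[of "fst x" "snd x" "fst y" "snd y"] xy by (metis prod.collapse)
  then have \<sigma>x: "map_prod \<sigma> \<sigma> x = y"
    by (simp add: prod_eq_iff)
  have sub: "map_prod \<sigma> \<sigma> ` U x \<subseteq> U y"
  proof (rule image_subsetI)
    fix z assume "z \<in> U x"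
    then have "z \<in> A22 A" "le x z"
      by (auto simp: U_def)
    then show "map_prod \<sigma> \<sigma> z \<in> U y"
      using le_permute[OF \<sigma>(1) xy(1), of z] A22_permute[OF \<sigma>(1), of z]
      unfolding U_def \<sigma>x by blast
  qed
  have inj: "inj_on (map_prod \<sigma> \<sigma>) (U x)"
    by (rule inj_on_subset[OF prod.inj_map[OF permutes_inj permutes_inj]]) (use \<sigma>(1) in auto)
  have fin_U: "finite (U z)" for z
    using fin_A22 by (simp add: U_def)
  have "card (U x) \<le> card (U y)"
    by (rule card_inj_on_le[OF inj sub fin_U])
  moreover have "U y \<subseteq> U x"
    using le_trans[OF le] by (auto simp: U_def)
  ultimately have "U y = U x"
    by (intro card_seteq[OF fin_U])
  moreover have "x \<in> U x"
    using xy(1) le_refl by (simp add: U_def)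
  ultimately show ?thesis
    by (auto simp: U_def)
qed

text \<open>The first projection forces \<open>\<sigma> x0 = y0\<close>, and \<open>le\<close>
  follows. Conversely, symmetry of \<open>le\<close> makes each \<open>f\<close> choose the same
  position in both pairs, so any permutation carrying \<open>x\<close> to \<open>y\<close> entrywise
  is a witness.\<close>

lemma R2star_iff: "(x, y) \<in> R2star A F \<longleftrightarrow> x \<in> A22 A \<and> y \<in> A22 A \<and> le x y"
proof
  assume R: "(x, y) \<in> R2star A F"
  obtain x0 x1 y0 y1 where xy: "x = (x0, x1)" "y = (y0, y1)"
    by fastforce
  have mem: "x0 \<in> A" "x1 \<in> A" "y0 \<in> A" "y1 \<in> A" "x0 \<noteq> x1" "y0 \<noteq> y1"
    using R by (auto simp: R2star_def xy A22_def)
  obtain \<sigma> where \<sigma>: "\<sigma> permutes A"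
      "\<And>f. (2, f) \<in> F \<Longrightarrow> f [y0, y1] = \<sigma> (f [x0, x1])"
    using R by (auto simp: R2star_def R2_def xy)
  obtain p where p: "(2, p) \<in> F" "\<And>x y. x \<in> A \<Longrightarrow> y \<in> A \<Longrightarrow> p [x, y] = x"
    using fst_op by blast
  have "\<sigma> x0 = y0"
    using \<sigma>(2)[OF p(1)] p(2) mem by simp
  then have "le x y"
    unfolding le_def xy by (simp add: \<sigma>(2))
  then show "x \<in> A22 A \<and> y \<in> A22 A \<and> le x y"
    using mem by (simp add: xy A22_iff)
next
  assume *: "x \<in> A22 A \<and> y \<in> A22 A \<and> le x y"
  obtain x0 x1 y0 y1 where xy: "x = (x0, x1)" "y = (y0, y1)"
    by fastforce
  have mem: "x0 \<in> A" "x1 \<in> A" "y0 \<in> A" "y1 \<in> A" "x0 \<noteq> x1" "y0 \<noteq> y1"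
    using * by (auto simp: xy A22_def)
  obtain \<sigma> where \<sigma>: "\<sigma> permutes A" "\<sigma> x0 = y0" "\<sigma> x1 = y1"
    using ex_permutes_pair * xy by metis
  have "f [y0, y1] = \<sigma> (f [x0, x1])" if f: "(2, f) \<in> F" for f
  proof -
    have "f [x0, x1] = x0 \<longleftrightarrow> f [y0, y1] = y0"
      using * le_sym[of x y] f by (auto simp: le_def xy)
    then show ?thesis
      using binary_op_cases[OF f] mem \<sigma> by metis
  qed
  then show "(x, y) \<in> R2star A F"
    using \<sigma>(1) mem unfolding R2star_def R2_def xy A22_def by blast
qed

abbreviation sim :: "'a \<times> 'a \<Rightarrow> 'a \<times> 'a \<Rightarrow> bool" (infix "\<approx>" 50) where
  "x \<approx> y \<equiv> (x, y) \<in> R2star A F"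

lemma sim_sym: "x \<approx> y \<Longrightarrow> y \<approx> x"
  unfolding R2star_iff using le_sym[of x y] by blast

lemma sim_trans: "x \<approx> y \<Longrightarrow> y \<approx> z \<Longrightarrow> x \<approx> z"
  unfolding R2star_iff using le_trans[of x y z] by blast

lemma sim_refl: "x \<in> A22 A \<Longrightarrow> x \<approx> x"
  by (simp add: R2star_iff le_refl)

lemma sim_swap:
  assumes "(a, b) \<approx> (c, d)"
  shows "(b, a) \<approx> (d, c)"
proof -
  have mem: "a \<in> A" "b \<in> A" "c \<in> A" "d \<in> A" "a \<noteq> b" "c \<noteq> d" and le: "le (a, b) (c, d)"
    using assms by (auto simp: R2star_iff A22_def)
  \<comment> \<open>Exchanging the arguments turns first choices into second choices, so the
    implication is contraposed and comes out reversed; symmetry of the relation turns it round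
    again.\<close>
  have "le (d, c) (b, a)"
    unfolding le_def
  proof (intro allI impI)
    fix f assume f: "(2, f) \<in> F" "f [fst (d, c), snd (d, c)] = fst (d, c)"
    obtain g where g: "(2, g) \<in> F" "\<And>x y. x \<in> A \<Longrightarrow> y \<in> A \<Longrightarrow> g [x, y] = f [y, x]"
      using swap_op[OF f(1)] by blast
    have "g [c, d] \<noteq> c"
      using g(2) f(2) mem by simp
    then have "g [a, b] \<noteq> a"
      using le g(1) by (auto simp: le_def)
    then have "f [b, a] = b"
      using g(2) mem binary_op_cases[OF f(1), of b a] by auto
    then show "f [fst (b, a), snd (b, a)] = fst (b, a)"
      by simp
  qed
  then show ?thesis
    using mem by - (rule sim_sym, simp add: R2star_iff A22_iff)
qed

lemma sim_permute: "x \<approx> y \<Longrightarrow> \<sigma> permutes A \<Longrightarrow> map_prod \<sigma> \<sigma> x \<approx> map_prod \<sigma> \<sigma> y"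
  unfolding R2star_iff using le_permute A22_permute by blast

text \<open>The form in which symmetry is used for the classification: only the entries that occur
  need an injective renaming.\<close>

lemma sim_rename:
  assumes "(a, b) \<approx> (c, d)" "inj_on f {a, b, c, d}" "f ` {a, b, c, d} \<subseteq> A"
  shows "(f a, f b) \<approx> (f c, f d)"
proof -
  have "{a, b, c, d} \<subseteq> A"
    using assms(1) by (auto simp: R2star_iff A22_def)
  then obtain \<sigma> where "\<sigma> permutes A" "\<forall>x\<in>{a, b, c, d}. \<sigma> x = f x"
    using ex_permutes_extending[OF fin _ assms(3,2)] by blast
  then show ?thesis
    using sim_permute[OF assms(1)] by force
qed

section \<open>Realising saturated sets of pairs by binary members\<close>

lemma separating_op:
  assumes "x \<in> A22 A" "y \<in> A22 A" "\<not> x \<approx> y"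
  obtains f where "(2, f) \<in> F" "f [fst x, snd x] = fst x" "f [fst y, snd y] = snd y"
proof -
  obtain f where f: "(2, f) \<in> F" "f [fst x, snd x] = fst x" "f [fst y, snd y] \<noteq> fst y"
    using assms by (auto simp: R2star_iff le_def)
  then have "f [fst y, snd y] = snd y"
    using binary_op_cases[OF f(1), of "fst y" "snd y"] assms(2) by (auto simp: A22_def)
  then show ?thesis
    using that f by blast
qed

lemma meet_separating_op:
  assumes "finite S" "S \<subseteq> A22 A" "y \<in> A22 A" "\<forall>x\<in>S. \<not> x \<approx> y"
  shows "\<exists>f. (2, f) \<in> F \<and> (\<forall>x\<in>S. f [fst x, snd x] = fst x) \<and> f [fst y, snd y] = snd y"
  using assms
proof (induction S)
  case empty
  obtain p where "(2, p) \<in> F" "\<And>x y. x \<in> A \<Longrightarrow> y \<in> A \<Longrightarrow> p [x, y] = y"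
    using snd_op by blast
  moreover have "fst y \<in> A" "snd y \<in> A"
    using assms(3) by (auto simp: A22_def)
  ultimately show ?case
    by auto
next
  case (insert x S)
  then obtain f where f: "(2, f) \<in> F" "\<And>x. x \<in> S \<Longrightarrow> f [fst x, snd x] = fst x"
      "f [fst y, snd y] = snd y"
    by auto
  obtain g where g: "(2, g) \<in> F" "g [fst x, snd x] = fst x" "g [fst y, snd y] = snd y"
    using separating_op[of x y] insert.prems by auto
  obtain p where p: "(2, p) \<in> F" "\<And>x y. x \<in> A \<Longrightarrow> y \<in> A \<Longrightarrow> p [x, y] = x"
    using fst_op by blast
  \<comment> \<open>\<open>f [x, g [x, y]]\<close> returns the first entry as soon as
    \<open>f\<close> or \<open>g\<close> does: first-choice sets are closed under union.\<close>
  obtain h where h: "(2, h) \<in> F"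
      "\<And>x y. x \<in> A \<Longrightarrow> y \<in> A \<Longrightarrow> h [x, y] = f [p [x, y], g [x, y]]"
    using comp_binary2[OF f(1) p(1) g(1)] by blast
  have idem: "f [a, a] = a" if "a \<in> A" for a
    using binary_op_cases[OF f(1) that that] by simp
  have "h [fst z, snd z] = fst z" if "z \<in> insert x S" for z
  proof (cases "z = x")
    case True
    then show ?thesis
      using h(2) p(2) g(2) idem insert.prems by (auto simp: A22_def)
  next
    case False
    then have "z \<in> S" "z \<in> A22 A"
      using that insert.prems by auto
    then have "fst z \<in> A" "snd z \<in> A"
      by (auto simp: A22_def)
    then show ?thesis
      using h(2) p(2) f(2)[OF \<open>z \<in> S\<close>] idem binary_op_cases[OF g(1), of "fst z" "snd z"] by auto
  qed
  moreover have "h [fst y, snd y] = snd y"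
    using h(2) p(2) g(3) f(3) \<open>y \<in> A22 A\<close> by (auto simp: A22_def)
  ultimately show ?case
    using h(1) by blast
qed

lemma selector_on_finite:
  assumes "finite T" "S \<subseteq> A22 A" "T \<subseteq> A22 A" "\<forall>x\<in>S. \<forall>y\<in>T. \<not> x \<approx> y"
  shows "\<exists>f. (2, f) \<in> F \<and> (\<forall>x\<in>S. f [fst x, snd x] = fst x)
    \<and> (\<forall>y\<in>T. f [fst y, snd y] = snd y)"
  using assms(1,3,4)
proof (induction T)
  case empty
  obtain p where "(2, p) \<in> F" "\<And>x y. x \<in> A \<Longrightarrow> y \<in> A \<Longrightarrow> p [x, y] = x"
    using fst_op by blast
  moreover have "fst x \<in> A" "snd x \<in> A" if "x \<in> S" for x
    using that assms(2) by (auto simp: A22_def)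
  ultimately show ?case
    by auto
next
  case (insert y T)
  then have "\<exists>f. (2, f) \<in> F \<and> (\<forall>x\<in>S. f [fst x, snd x] = fst x)
      \<and> (\<forall>y\<in>T. f [fst y, snd y] = snd y)"
    by auto
  then obtain f where f: "(2, f) \<in> F" "\<And>x. x \<in> S \<Longrightarrow> f [fst x, snd x] = fst x"
      "\<And>y. y \<in> T \<Longrightarrow> f [fst y, snd y] = snd y"
    by blast
  have "finite S"
    by (rule finite_subset[of _ "A \<times> A"]) (use assms(2) fin in \<open>auto simp: A22_def\<close>)
  then obtain g where g: "(2, g) \<in> F" "\<And>x. x \<in> S \<Longrightarrow> g [fst x, snd x] = fst x"
      "g [fst y, snd y] = snd y"
    using meet_separating_op[of S y] assms(2) insert.prems by (meson insertI1 insert_subset)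
  obtain p where p: "(2, p) \<in> F" "\<And>x y. x \<in> A \<Longrightarrow> y \<in> A \<Longrightarrow> p [x, y] = y"
    using snd_op by blast
  \<comment> \<open>\<open>f [g [x, y], y]\<close> returns the first entry exactly where both
    \<open>f\<close> and \<open>g\<close> do: first-choice sets are closed under
    intersection.\<close>
  obtain h where h: "(2, h) \<in> F"
      "\<And>x y. x \<in> A \<Longrightarrow> y \<in> A \<Longrightarrow> h [x, y] = f [g [x, y], p [x, y]]"
    using comp_binary2[OF f(1) g(1) p(1)] by blast
  have idem: "f [a, a] = a" if "a \<in> A" for a
    using binary_op_cases[OF f(1) that that] by simp
  have "h [fst z, snd z] = snd z" if "z \<in> insert y T" for z
  proof (cases "z = y")
    case True
    then show ?thesis
      using h(2) p(2) g(3) idem insert.prems by (auto simp: A22_def)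
  next
    case False
    then have "z \<in> T" "z \<in> A22 A"
      using that insert.prems by auto
    then have "fst z \<in> A" "snd z \<in> A"
      by (auto simp: A22_def)
    then show ?thesis
      using h(2) p(2) f(3)[OF \<open>z \<in> T\<close>] idem binary_op_cases[OF g(1), of "fst z" "snd z"] by auto
  qed
  moreover have "h [fst x, snd x] = fst x" if "x \<in> S" for x
    using h(2) p(2) g(2) f(2) that assms(2) by (auto simp: A22_def)
  ultimately show ?case
    using h(1) by blast
qed

text \<open>Off the diagonal a saturated set and its complement contain no related pairs, so they
  can be separated. On the diagonal both choices coincide.\<close>

lemma selector:
  assumes sat: "\<And>x y. x \<approx> y \<Longrightarrow> x \<in> S \<Longrightarrow> y \<in> S"
  obtains f where "(2, f) \<in> F"
    "\<And>a b. a \<in> A \<Longrightarrow> b \<in> A \<Longrightarrow> f [a, b] = (if (a, b) \<in> S then a else b)"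
proof -
  have "finite (A22 A - S)"
    by (rule finite_subset[of _ "A \<times> A"]) (auto simp: A22_def fin)
  then obtain f where f: "(2, f) \<in> F" "\<forall>x\<in>A22 A \<inter> S. f [fst x, snd x] = fst x"
      "\<forall>y\<in>A22 A - S. f [fst y, snd y] = snd y"
    using selector_on_finite[OF _ Int_lower1 Diff_subset] sat by (metis DiffD2 IntD2)
  have "f [a, b] = (if (a, b) \<in> S then a else b)" if "a \<in> A" "b \<in> A" for a b
  proof (cases "a = b")
    case True
    then show ?thesis
      using binary_op_cases[OF f(1) that] by simp
  next
    case False
    then show ?thesis
      using f(2,3) that by (force simp: A22_iff)
  qed
  then show ?thesis
    using f(1) that by blast
qed

text \<open>Decomposability exploits closure of \<open>H\<close> under operations only in this form:
  two members may be spliced by any rule that respects the equivalence.\<close>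

lemma Inv_selection:
  assumes H: "H \<in> Inv A Q F" "k \<in> H" "l \<in> H"
    and sat: "\<And>a b c d. (a, b) \<approx> (c, d) \<Longrightarrow> S a b \<Longrightarrow> S c d"
  shows "\<exists>m\<in>H. \<forall>q\<in>Q. m q = (if S (k q) (l q) then k q else l q)"
proof -
  have "\<And>x y. x \<approx> y \<Longrightarrow> x \<in> {(a, b). S a b} \<Longrightarrow> y \<in> {(a, b). S a b}"
    using sat by auto
  then obtain f where f: "(2, f) \<in> F"
    "\<And>a b. a \<in> A \<Longrightarrow> b \<in> A \<Longrightarrow> f [a, b] = (if (a, b) \<in> {(a, b). S a b} then a else b)"
    using selector[of "{(a, b). S a b}"] by blast
  have sub: "H \<subseteq> Q \<rightarrow>\<^sub>E A"
    using H(1) by (simp add: Inv_def)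
  have "agrees_on H (\<lambda>q. f (map (\<lambda>h. h q) [k, l])) Q"
    using H f(1) unfolding in_Inv_iff[OF sub] closed_on_def
    by (metis One_nat_def Suc_1 empty_set empty_subsetI insert_subset length_Cons list.simps(15) list.size(3))
  then obtain m where "m \<in> H" "\<forall>q\<in>Q. m q = f [k q, l q]"
    by (auto simp: agrees_on_def)
  moreover have "k q \<in> A" "l q \<in> A" if "q \<in> Q" for q
    using that sub H(2,3) by auto
  ultimately show ?thesis
    using f(2) by (intro bexI[of _ m]) auto
qed

subsection \<open>The possible equivalence relations\<close>

lemma sim_mem: "(a, b) \<approx> (c, d) \<Longrightarrow> {a, b, c, d} \<subseteq> A \<and> a \<noteq> b \<and> c \<noteq> d"
  by (simp add: R2star_iff A22_iff)

text \<open>Renaming relates all pairs with the same first entry, and swapping relates all pairs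
  with the same second entry. Any pair is reached from any other by changing one entry at a time, as
  long as the entries stay distinct.\<close>

lemma sim_total_if_common_fst:
  assumes "(a, b) \<approx> (a, c)" "b \<noteq> c" "x \<in> A22 A" "y \<in> A22 A"
  shows "x \<approx> y"
proof -
  have abc: "{a, b, c} \<subseteq> A" "a \<noteq> b" "a \<noteq> c"
    using sim_mem[OF assms(1)] by auto
  have row: "(x, y) \<approx> (x, z)" if "{x, y, z} \<subseteq> A" "x \<noteq> y" "x \<noteq> z" for x y z
  proof (cases "y = z")
    case True
    then show ?thesis
      using that by (simp add: sim_refl A22_iff)
  next
    case False
    have "((\<lambda>t. if t = a then x else if t = b then y else z) a,
           (\<lambda>t. if t = a then x else if t = b then y else z) b)
      \<approx> ((\<lambda>t. if t = a then x else if t = b then y else z) a,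
         (\<lambda>t. if t = a then x else if t = b then y else z) c)"
      by (rule sim_rename[OF assms(1)]) (use that False in \<open>auto simp: inj_on_def\<close>)
    then show ?thesis
      using abc assms(2) by simp
  qed
  have col: "(y, x) \<approx> (z, x)" if "{x, y, z} \<subseteq> A" "x \<noteq> y" "x \<noteq> z" for x y z
    using sim_swap[OF row[OF that]] .
  obtain x0 x1 y0 y1 where xy: "x = (x0, x1)" "y = (y0, y1)"
    by fastforce
  have mem: "x0 \<in> A" "x1 \<in> A" "y0 \<in> A" "y1 \<in> A" "x0 \<noteq> x1" "y0 \<noteq> y1"
    using assms(3,4) by (auto simp: xy A22_iff)
  consider "y1 \<noteq> x0" | "y1 = x0" "y0 \<noteq> x1" | "y1 = x0" "y0 = x1"
    by blast
  then show ?thesis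
  proof cases
    case 1
    have "(x0, x1) \<approx> (x0, y1)"
      using mem 1 by (intro row) auto
    also have "(x0, y1) \<approx> (y0, y1)"
      using mem 1 by (intro col) auto
    finally (sim_trans) show ?thesis
      unfolding xy .
  next
    case 2
    have "(x0, x1) \<approx> (y0, x1)"
      using mem 2 by (intro col) auto
    also have "(y0, x1) \<approx> (y0, x0)"
      using mem 2 by (intro row) auto
    finally (sim_trans) show ?thesis
      unfolding xy 2 .
  next
    case 3
    \<comment> \<open>A reversed pair cannot be reached through its own two entries; a third element
      is needed as an intermediate stop, and \<open>a\<close>, \<open>b\<close>, \<open>c\<close>
      are three distinct ones.\<close>
    obtain e where e: "e \<in> A" "e \<noteq> x0" "e \<noteq> x1"
      using abc assms(2) by (cases "a \<in> {x0, x1}"; cases "b \<in> {x0, x1}"; cases "c \<in> {x0, x1}") auto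
    have 1: "(x0, x1) \<approx> (e, x1)"
      using mem e by (intro col) auto
    have 2: "(e, x1) \<approx> (e, x0)"
      using mem e by (intro row) auto
    have 3: "(e, x0) \<approx> (x1, x0)"
      using mem e by (intro col) auto
    show ?thesis
      unfolding xy \<open>y1 = x0\<close> \<open>y0 = x1\<close> by (rule sim_trans[OF sim_trans[OF 1 2] 3])
  qed
qed

definition sim_total :: bool where
  "sim_total \<longleftrightarrow> (\<forall>x\<in>A22 A. \<forall>y\<in>A22 A. x \<approx> y)"

lemma sim_total_if_fst: "(a, b) \<approx> (a, c) \<Longrightarrow> b \<noteq> c \<Longrightarrow> sim_total"
  unfolding sim_total_def using sim_total_if_common_fst by blast

lemma sim_total_if_snd: "(b, a) \<approx> (c, a) \<Longrightarrow> b \<noteq> c \<Longrightarrow> sim_total"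
  using sim_total_if_fst sim_swap by blast

text \<open>A fourth element \<open>e\<close> would give
  \<open>(b, c) \<approx> (a, b) \<approx> (b, e)\<close>, two related pairs with a common first
  entry. A reversal \<open>(x, y) \<approx> (y, x) \<approx> (x, z)\<close> would do the same. What
  remains is the cyclic relation on three points.\<close>

lemma sim_chain_cases:
  assumes sim: "(a, b) \<approx> (b, c)" and "a \<noteq> c"
    and nt: "\<not> sim_total"
  shows "card A = 3 \<and> R2star A F = R_up A"
proof -
  have abc: "{a, b, c} \<subseteq> A" "a \<noteq> b" "b \<noteq> c"
    using sim_mem[OF sim] by auto
  have gen: "(x, y) \<approx> (y, z)" if "{x, y, z} \<subseteq> A" "x \<noteq> y" "x \<noteq> z" "y \<noteq> z" for x y z
  proof -
    have "((\<lambda>t. if t = a then x else if t = b then y else z) a,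
           (\<lambda>t. if t = a then x else if t = b then y else z) b)
      \<approx> ((\<lambda>t. if t = a then x else if t = b then y else z) b,
         (\<lambda>t. if t = a then x else if t = b then y else z) c)"
      by (rule sim_rename[OF sim]) (use that in \<open>auto simp: inj_on_def\<close>)
    then show ?thesis
      using abc assms(2) by simp
  qed
  have A: "A = {a, b, c}"
  proof (rule ccontr)
    assume "A \<noteq> {a, b, c}"
    then obtain e where e: "e \<in> A" "e \<notin> {a, b, c}"
      using abc by blast
    have "(b, c) \<approx> (a, b)"
      by (rule sim_sym[OF sim])
    also have "(a, b) \<approx> (b, e)"
      using e abc by (intro gen) auto
    finally (sim_trans) have "(b, c) \<approx> (b, e)" .
    then show False
      using sim_total_if_fst nt e by blast
  qed
  have not_swap: "\<not> (x, y) \<approx> (y, x)" for x y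
  proof
    assume xy: "(x, y) \<approx> (y, x)"
    obtain z where z: "z \<in> A" "z \<noteq> x" "z \<noteq> y"
      using abc assms(2) by (cases "a \<in> {x, y}"; cases "b \<in> {x, y}"; cases "c \<in> {x, y}") auto
    have "(y, x) \<approx> (x, z)"
      using z sim_mem[OF xy] by (intro gen) auto
    then have "(x, y) \<approx> (x, z)"
      by (rule sim_trans[OF xy])
    then show False
      using sim_total_if_fst nt z by blast
  qed
  have "R_up A \<subseteq> R2star A F"
  proof
    fix p assume "p \<in> R_up A"
    then obtain x y u v where p: "p = ((x, y), (u, v))"
      and mem: "x \<in> A" "y \<in> A" "u \<in> A" "v \<in> A" "x \<noteq> y" "u \<noteq> v"
      and "(x, y) = (u, v) \<or> (y = u \<and> x \<noteq> v) \<or> (x = v \<and> y \<noteq> u)"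
      by (auto simp: R_up_def A22_iff)
    then consider "(x, y) = (u, v)" | "y = u" "x \<noteq> v" | "x = v" "y \<noteq> u"
      by blast
    then show "p \<in> R2star A F"
    proof cases
      case 1
      then show ?thesis
        using mem by (simp add: p sim_refl A22_iff)
    next
      case 2
      then show ?thesis
        using mem gen[of x y v] by (simp add: p)
    next
      case 3
      then show ?thesis
        using mem sim_sym[OF gen[of u v y]] by (simp add: p)
    qed
  qed
  moreover have "R2star A F \<subseteq> R_up A"
  proof
    fix p assume p: "p \<in> R2star A F"
    obtain x y u v where p_eq: "p = ((x, y), (u, v))"
      by (metis surj_pair)
    then have sim': "(x, y) \<approx> (u, v)"
      using p by simp
    have mem: "{x, y, u, v} \<subseteq> A" "x \<noteq> y" "u \<noteq> v"
      using sim_mem[OF sim'] by auto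
    have "x = u \<Longrightarrow> y = v" "y = v \<Longrightarrow> x = u"
      using sim' sim_total_if_fst sim_total_if_snd nt by blast+
    moreover have "\<not> (y = u \<and> x = v)"
      using sim' not_swap by blast
    ultimately have "(x, y) = (u, v) \<or> (y = u \<and> x \<noteq> v) \<or> (x = v \<and> y \<noteq> u)"
      using mem unfolding A by auto
    then show "p \<in> R_up A"
      using mem by (simp add: R_up_def p_eq A22_iff)
  qed
  ultimately show "card A = 3 \<and> R2star A F = R_up A"
    using abc assms(2) by (simp add: A)
qed

text \<open>A fifth element would again relate two pairs with a common first entry. With four
  elements, a pair is related to its reversal through the complementary pair.\<close>

lemma sim_disjoint_cases:
  assumes sim: "(a, b) \<approx> (c, d)" and disj: "{a, b} \<inter> {c, d} = {}"
    and nt: "\<not> sim_total"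
  shows "card A = 4 \<and> R2star A F = R_pm A"
proof -
  have abcd: "{a, b, c, d} \<subseteq> A" "a \<noteq> b" "c \<noteq> d"
    using sim_mem[OF sim] by auto
  have gen: "(x, y) \<approx> (z, w)" if "{x, y, z, w} \<subseteq> A" "x \<noteq> y" "z \<noteq> w" "{x, y} \<inter> {z, w} = {}" for x y z w
  proof -
    have "((\<lambda>t. if t = a then x else if t = b then y else if t = c then z else w) a,
           (\<lambda>t. if t = a then x else if t = b then y else if t = c then z else w) b)
      \<approx> ((\<lambda>t. if t = a then x else if t = b then y else if t = c then z else w) c,
         (\<lambda>t. if t = a then x else if t = b then y else if t = c then z else w) d)"
      by (rule sim_rename[OF sim]) (use that in \<open>auto simp: inj_on_def\<close>)
    then show ?thesis
      using abcd disj by simp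
  qed
  have A: "A = {a, b, c, d}"
  proof (rule ccontr)
    assume "A \<noteq> {a, b, c, d}"
    then obtain e where e: "e \<in> A" "e \<notin> {a, b, c, d}"
      using abcd by blast
    have "(c, d) \<approx> (a, b)"
      by (rule sim_sym[OF sim])
    also have "(a, b) \<approx> (c, e)"
      using e abcd disj by (intro gen) auto
    finally (sim_trans) have "(c, d) \<approx> (c, e)" .
    then show False
      using sim_total_if_fst nt e by blast
  qed
  have card: "card A = 4"
    using abcd disj by (auto simp: A card_insert_if)
  have swap: "(x, y) \<approx> (y, x)" if "x \<in> A" "y \<in> A" "x \<noteq> y" for x y
  proof -
    have "card (A - {x, y}) = 2"
      using card that fin by (simp add: card_Diff_subset)
    then obtain z w where "A - {x, y} = {z, w}" "z \<noteq> w"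
      by (auto simp: card_2_iff)
    then have zw: "{x, y, z, w} \<subseteq> A" "z \<noteq> w" "{x, y} \<inter> {z, w} = {}"
      using that by auto
    have "(x, y) \<approx> (z, w)"
      using zw that by (intro gen) auto
    also have "(z, w) \<approx> (y, x)"
      using zw that by (intro gen) auto
    finally (sim_trans) show ?thesis .
  qed
  have "R_pm A \<subseteq> R2star A F"
  proof
    fix p assume "p \<in> R_pm A"
    then obtain x y u v where p: "p = ((x, y), (u, v))"
      and mem: "x \<in> A" "y \<in> A" "u \<in> A" "v \<in> A" "x \<noteq> y" "u \<noteq> v"
      and "{x, y} = {u, v} \<or> {x, y} \<inter> {u, v} = {}"
      by (auto simp: R_pm_def A22_iff)
    then consider "(x, y) = (u, v)" | "x = v" "y = u" | "{x, y} \<inter> {u, v} = {}"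
      by (auto simp: doubleton_eq_iff)
    then show "p \<in> R2star A F"
    proof cases
      case 1
      then show ?thesis
        using mem by (simp add: p sim_refl A22_iff)
    next
      case 2
      then show ?thesis
        using mem swap[of x y] by (simp add: p)
    next
      case 3
      then show ?thesis
        using mem gen[of x y u v] by (simp add: p)
    qed
  qed
  moreover have "R2star A F \<subseteq> R_pm A"
  proof
    fix p assume p: "p \<in> R2star A F"
    obtain x y u v where p_eq: "p = ((x, y), (u, v))"
      by (metis surj_pair)
    then have sim': "(x, y) \<approx> (u, v)"
      using p by simp
    have mem: "x \<in> A" "y \<in> A" "u \<in> A" "v \<in> A" "x \<noteq> y" "u \<noteq> v"
      using sim_mem[OF sim'] by auto
    have fst: "x = u \<Longrightarrow> y = v" and snd: "y = v \<Longrightarrow> x = u"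
      using sim' sim_total_if_fst sim_total_if_snd nt by blast+
    have "(x, y) \<approx> (v, u)"
      by (rule sim_trans[OF sim' swap[OF mem(3,4,6)]])
    then have "x = v \<longleftrightarrow> y = u"
      using sim_total_if_fst sim_total_if_snd nt by blast
    moreover have "x = u \<longleftrightarrow> y = v"
      using fst snd by blast
    ultimately have "{x, y} = {u, v} \<or> {x, y} \<inter> {u, v} = {}"
      by (cases "x = u"; cases "x = v") auto
    then show "p \<in> R_pm A"
      using mem by (simp add: R_pm_def p_eq A22_iff)
  qed
  ultimately show "card A = 4 \<and> R2star A F = R_pm A"
    using card by simp
qed

text \<open>Related pairs with different ranges share an entry in the same position, share one
  crosswise, or are disjoint; each is excluded. Only ranges are compared, so equality and "same
  range" are treated together.\<close>

lemma sim_cases: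
  assumes nt: "\<not> sim_total"
    and "\<not> (card A = 4 \<and> R2star A F = R_pm A)" "\<not> (card A = 3 \<and> R2star A F = R_up A)"
    and sim: "(a, b) \<approx> (c, d)"
  shows "{a, b} = {c, d}"
proof (rule ccontr)
  assume ne: "{a, b} \<noteq> {c, d}"
  have no_chain: "\<not> (x, y) \<approx> (y, z)" if "x \<noteq> z" for x y z
    using sim_chain_cases that assms by blast
  consider "a = c" | "b = d" | "a = d" | "b = c" | "{a, b} \<inter> {c, d} = {}"
    by blast
  then show False
  proof cases
    case 1
    then show ?thesis
      using sim_total_if_fst sim nt ne by blast
  next
    case 2
    then show ?thesis
      using sim_total_if_snd sim nt ne by blast
  next
    case 3
    then show ?thesis
      using no_chain[of c b a] sim_sym[OF sim] ne by auto
  next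
    case 4
    then show ?thesis
      using no_chain[of a d b] sim ne by auto
  next
    case 5
    then show ?thesis
      using sim_disjoint_cases[OF sim] assms by blast
  qed
qed

text \<open>Under the total relation a binary member returns the first entry at all pairs or the
  second at all pairs, hence is a projection.\<close>

lemma not_sim_total:
  assumes "clone_rank A F = 2"
  shows "\<not> sim_total"
proof
  assume total: "sim_total"
  \<comment> \<open>The default rank 0 differs from 2, so a non-projection exists and the least
    arity is attained.\<close>
  have "\<exists>r f. (r, f) \<in> F \<and> \<not> is_proj A r f"
    using assms by (auto simp: clone_rank_def split: if_splits)
  then have "\<exists>f. (2, f) \<in> F \<and> \<not> is_proj A 2 f"
    using assms LeastI_ex[of "\<lambda>r. \<exists>f. (r, f) \<in> F \<and> \<not> is_proj A r f"]
    by (simp add: clone_rank_def)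
  then obtain f where f: "(2, f) \<in> F" "\<not> is_proj A 2 f"
    by blast
  have ext: "f \<in> tuples A 2 \<rightarrow>\<^sub>E A"
    using clone f(1) by (auto simp: clone_def ops_def)
  have not_proj: "\<exists>x y. x \<in> A \<and> y \<in> A \<and> f [x, y] \<noteq> [x, y] ! i" if "i < 2" for i
  proof (rule ccontr)
    assume *: "\<nexists>x y. x \<in> A \<and> y \<in> A \<and> f [x, y] \<noteq> [x, y] ! i"
    have "f xs = proj A 2 i xs" for xs
    proof (cases "xs \<in> tuples A 2")
      case True
      then obtain x y where "xs = [x, y]" "x \<in> A" "y \<in> A"
        by (auto simp: tuples_def length_Suc_conv numeral_2_eq_2)
      then show ?thesis
        using * True by (simp add: proj_def)
    next
      case False
      then show ?thesis
        using PiE_arb[OF ext] by (simp add: proj_def)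
    qed
    then show False
      using f(2) that by (auto simp: is_proj_def)
  qed
  obtain a b where ab: "a \<in> A" "b \<in> A" "f [a, b] \<noteq> a"
    using not_proj[of 0] by auto
  obtain c d where cd: "c \<in> A" "d \<in> A" "f [c, d] \<noteq> d"
    using not_proj[of 1] by auto
  have "f [a, b] = b" "f [c, d] = c"
    using binary_op_cases[OF f(1)] ab cd by blast+
  then have "(a, b) \<in> A22 A" "(c, d) \<in> A22 A"
    using ab cd by (auto simp: A22_iff)
  then have "le (c, d) (a, b)"
    using total by (simp add: sim_total_def R2star_iff)
  then show False
    using f(1) \<open>f [c, d] = c\<close> ab(3) by (simp add: le_def)
qed

end

section \<open>Minimal disagreements\<close>

text \<open>All near misses deviate from \<open>h\<close> within one pair \<open>B\<close>. Since
  \<open>QB Q H B\<close> is matched, some member takes a value \<open>c\<close> outside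
  \<open>B\<close> on \<open>P\<close>; this shrinks \<open>P\<close> to two coordinates, on which
  all members of \<open>H\<close> then turn out to be equal.\<close>

lemma agrees_on_if_locally_agrees:
  assumes fin: "finite Q" and H: "H \<noteq> {}" "H \<subseteq> Q \<rightarrow>\<^sub>E A" and h: "h \<in> Q \<rightarrow>\<^sub>E A"
    and sel: "\<And>k l \<S>. k \<in> H \<Longrightarrow> l \<in> H
      \<Longrightarrow> \<exists>m\<in>H. \<forall>q\<in>Q. m q = (if {k q, l q} \<in> \<S> then k q else l q)"
    and loc1: "\<And>q. q \<in> Q \<Longrightarrow> agrees_on H h {q}"
    and loc_id: "\<And>R. R \<in> pairs_id Q H \<Longrightarrow> agrees_on H h R"
    and loc_B: "\<And>B. B \<in> ksubsets A 2 \<Longrightarrow> agrees_on H h (QB Q H B)"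
  shows "agrees_on H h Q"
proof (rule ccontr)
  assume "\<not> agrees_on H h Q"
  from ex_minimal_disagreement[OF fin H(1) this]
  obtain P where P: "P \<subseteq> Q" "P \<noteq> {}" "\<not> agrees_on H h P"
    and almost: "\<forall>q\<in>P. agrees_on H h (P - {q})"
    by auto
  have disagree: "\<exists>q\<in>P. k q \<noteq> h q" if "k \<in> H" for k
    using P(3) that by (auto simp: agrees_on_def)
  have sel': "\<exists>m\<in>H. \<forall>q\<in>P. m q = (if {k q, l q} \<in> \<S> then k q else l q)"
    if "k \<in> H" "l \<in> H" for k l \<S>
    using sel[OF that, of \<S>] P(1) by blast
  define N where "N q k \<longleftrightarrow> k \<in> H \<and> (\<forall>p\<in>P - {q}. k p = h p)" for q k
  have N_ex: "\<exists>k. N q k" if "q \<in> P" for q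
    using almost that by (auto simp: agrees_on_def N_def)
  have N_in: "k \<in> H" if "N q k" for q k
    using that by (simp add: N_def)
  have N_ne: "k q \<noteq> h q" if "N q k" for q k
    using disagree[of k] that by (auto simp: N_def)
  have N_pair: "{k p, h p} = {l q, h q}" if "p \<in> P" "q \<in> P" "p \<noteq> q" "N p k" "N q l" for p q k l
  proof (rule ccontr)
    assume ne: "{k p, h p} \<noteq> {l q, h q}"
    \<comment> \<open>This takes \<open>k\<close> at \<open>q\<close> and \<open>l\<close> at
      \<open>p\<close>. Both equal \<open>h\<close> there, so \<open>m\<close> would match
      \<open>h\<close> on all of \<open>P\<close>.\<close>
    obtain m where m: "m \<in> H" "\<forall>r\<in>P. m r = (if {k r, l r} \<in> {{l q, h q}} then k r else l r)"
      using sel'[OF N_in[OF \<open>N p k\<close>] N_in[OF \<open>N q l\<close>], of "{{l q, h q}}"] by blast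
    have "m r = h r" if "r \<in> P" for r
    proof -
      have "m r = (if {k r, l r} = {l q, h q} then k r else l r)"
        using m(2) that by simp
      moreover have "k r = h r" if "r \<noteq> p"
        using that \<open>r \<in> P\<close> \<open>N p k\<close> by (simp add: N_def)
      moreover have "l r = h r" if "r \<noteq> q"
        using that \<open>r \<in> P\<close> \<open>N q l\<close> by (simp add: N_def)
      ultimately show ?thesis
        using ne \<open>p \<noteq> q\<close> by (cases "r = p"; cases "r = q") (auto simp: insert_commute)
    qed
    then show False
      using disagree[OF m(1)] by blast
  qed
  have two: "\<exists>p\<in>P. p \<noteq> q" if "q \<in> P" for q
  proof (rule ccontr)
    assume "\<not> (\<exists>p\<in>P. p \<noteq> q)"
    then have "P = {q}"
      using that by blast
    then show False
      using loc1[of q] P by auto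
  qed
  obtain q0 l0 where q0: "q0 \<in> P" "N q0 l0"
    using P(2) N_ex by blast
  define B where "B = {l0 q0, h q0}"
  have N_B: "{k q, h q} = B" if "q \<in> P" "N q k" for q k
  proof (cases "q = q0")
    case False
    then show ?thesis
      using N_pair[OF that(1) q0(1) _ that(2) q0(2)] by (simp add: B_def)
  next
    case True
    obtain p l where p: "p \<in> P" "p \<noteq> q0" "N p l"
      using two[OF q0(1)] N_ex by blast
    then show ?thesis
      using N_pair[of p q0 l k] N_pair[of p q0 l l0] that q0 True by (simp add: B_def)
  qed
  have h_B: "h q \<in> B" if "q \<in> P" for q
    using N_B N_ex that by blast
  have "B \<in> ksubsets A 2"
  proof -
    have "l0 \<in> Q \<rightarrow>\<^sub>E A"
      using q0(2) H(2) by (auto simp: N_def)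
    moreover have "q0 \<in> Q"
      using q0(1) P(1) by blast
    ultimately have "l0 q0 \<in> A" "h q0 \<in> A"
      using PiE_mem[of l0 Q _ q0] PiE_mem[OF h, of q0] by auto
    then show ?thesis
      using N_ne[OF q0(2)] by (simp add: ksubsets_def B_def)
  qed
  then have "agrees_on H h (QB Q H B)"
    by (rule loc_B)
  then have "\<not> P \<subseteq> QB Q H B"
    using P(3) agrees_on_mono by blast
  then obtain q k where q: "q \<in> P" and k: "k \<in> H" "k q \<notin> B"
    using P(1) by (auto simp: QB_def Hq_def)
  obtain hq where hq: "N q hq"
    using N_ex[OF q] by blast
  define a where "a = h q"
  define b where "b = hq q"
  define c where "c = k q"
  have B: "B = {a, b}" "a \<noteq> b" "c \<noteq> a" "c \<noteq> b"
    using N_B[OF q hq] N_ne[OF hq] k(2) by (auto simp: a_def b_def c_def)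
  \<comment> \<open>The pair \<open>{b, c}\<close> occurs at \<open>q\<close>, which keeps the value
    \<open>c\<close>. Elsewhere \<open>hq\<close> equals \<open>h\<close> with values in
    \<open>B\<close>, so the only possible change is from \<open>b\<close> to
    \<open>c\<close>.\<close>
  obtain k1 where k1: "k1 \<in> H"
      "\<forall>p\<in>P. k1 p = (if {k p, hq p} \<in> {{b, c}} then k p else hq p)"
    using sel'[OF k(1) N_in[OF hq], of "{{b, c}}"] by blast
  have k1_q: "k1 q = c"
    using k1(2) q by (auto simp: b_def c_def)
  have k1_other: "k1 p = h p \<or> (h p = b \<and> k1 p = c)" if "p \<in> P" "p \<noteq> q" for p
  proof -
    have "hq p = h p"
      using hq that by (simp add: N_def)
    then show ?thesis
      using k1(2) that h_B[of p] B by (auto simp: doubleton_eq_iff)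
  qed
  \<comment> \<open>A near miss at \<open>q\<close> with value \<open>c\<close> would deviate within
    \<open>{a, c}\<close> instead of \<open>B\<close>.\<close>
  have "\<not> N q k1"
    using N_B[OF q, of k1] k1_q B by (auto simp: a_def[symmetric])
  then obtain p where p: "p \<in> P" "p \<noteq> q" "k1 p \<noteq> h p"
    using k1(1) by (auto simp: N_def)
  then have pb: "h p = b" "k1 p = c"
    using k1_other by auto
  obtain hp where hp: "N p hp"
    using N_ex[OF p(1)] by blast
  have hp_p: "hp p = a"
    using N_B[OF p(1) hp] pb B by (auto simp: doubleton_eq_iff)
  have hp_other: "hp r = h r" if "r \<in> P" "r \<noteq> p" for r
    using hp that by (simp add: N_def)
  \<comment> \<open>The pair \<open>{c, a}\<close> occurs at \<open>q\<close> and at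
    \<open>p\<close> only, since all other changes of \<open>k1\<close> give \<open>{c, b}\<close>.
    Hence \<open>k2\<close> is \<open>c\<close> at \<open>p\<close> and \<open>q\<close> and equals
    \<open>h\<close> elsewhere.\<close>
  obtain k2 where k2: "k2 \<in> H"
      "\<forall>r\<in>P. k2 r = (if {k1 r, hp r} \<in> {{c, a}} then k1 r else hp r)"
    using sel'[OF k1(1) N_in[OF hp], of "{{c, a}}"] by blast
  have k2_q: "k2 q = c"
    using k2(2) q hp_other[OF q] p(2) k1_q by (auto simp: a_def)
  have k2_p: "k2 p = c"
    using k2(2) p hp_p pb by auto
  have k2_other: "k2 r = h r" if "r \<in> P" "r \<noteq> p" "r \<noteq> q" for r
    using k2(2) that hp_other[of r] k1_other[of r] B by (auto simp: doubleton_eq_iff)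
  have P_eq: "P = {p, q}"
  proof (rule ccontr)
    assume "P \<noteq> {p, q}"
    then obtain r where r: "r \<in> P" "r \<noteq> p" "r \<noteq> q"
      using p q by blast
    obtain hr where hr: "N r hr"
      using N_ex[OF r(1)] by blast
    have hr_r: "{hr r, h r} = {a, b}"
      using N_B[OF r(1) hr] B by simp
    have hr_other: "hr s = h s" if "s \<in> P" "s \<noteq> r" for s
      using hr that by (simp add: N_def)
    \<comment> \<open>The values meet as \<open>{c, a}\<close> at \<open>q\<close>, as
      \<open>{a, b}\<close> at \<open>r\<close> and as \<open>{c, b}\<close> at \<open>p\<close>.
      Selecting \<open>k2\<close> on the last two repairs \<open>q\<close> and \<open>r\<close>,
      leaving a near miss at \<open>p\<close> with the forbidden value \<open>c\<close>.\<close>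
    obtain m where m: "m \<in> H"
        "\<forall>s\<in>P. m s = (if {k2 s, hr s} \<in> {{c, b}, {a, b}} then k2 s else hr s)"
      using sel'[OF k2(1) N_in[OF hr], of "{{c, b}, {a, b}}"] by blast
    have "m s = h s" if s: "s \<in> P" "s \<noteq> p" for s
    proof -
      consider "s = q" | "s = r" | "s \<noteq> q" "s \<noteq> r"
        by blast
      then show ?thesis
      proof cases
        case 1
        then have "{k2 s, hr s} = {c, a}"
          using hr_other[OF s(1)] r k2_q by (simp add: a_def)
        then have "{k2 s, hr s} \<notin> {{c, b}, {a, b}}"
          using B by (auto simp: doubleton_eq_iff)
        then show ?thesis
          using m(2) s 1 hr_other[OF s(1)] r by simp
      next
        case 2
        then show ?thesis
          using m(2) s hr_r k2_other[OF r] by (simp add: insert_commute)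
      next
        case 3
        then show ?thesis
          using m(2) s hr_other[OF s(1)] k2_other[OF s] by simp
      qed
    qed
    then have "N p m"
      using m(1) by (simp add: N_def)
    moreover have "m p = c"
      using m(2) p(1) k2_p hr_other[OF p(1)] r pb by auto
    ultimately show False
      using N_B[OF p(1), of m] B by auto
  qed
  \<comment> \<open>The first argument is the value at \<open>q\<close>, the second at
    \<open>p\<close>. The function \<open>h\<close> is the missing pair \<open>(a, b)\<close>, while
    \<open>(a, a)\<close>, \<open>(b, b)\<close> and \<open>(c, c)\<close> occur; splicing any
    off-diagonal pair with these leads back to \<open>(a, b)\<close>.\<close>
  define X where "X x y \<longleftrightarrow> (\<exists>m\<in>H. m q = x \<and> m p = y)" for x y
  have X_sel: "X x y'" if XX: "X x y" "X x' y'" and ne: "{x, x'} \<noteq> {y, y'}" for x y x' y'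
  proof -
    obtain k l where kl: "k \<in> H" "k q = x" "k p = y" "l \<in> H" "l q = x'" "l p = y'"
      using XX unfolding X_def by blast
    obtain m where m: "m \<in> H" "\<forall>s\<in>P. m s = (if {k s, l s} \<in> {{x, x'}} then k s else l s)"
      using sel'[of k l "{{x, x'}}"] kl by blast
    have "m q = x" "m p = y'"
      using m(2) kl ne p q by auto
    then show ?thesis
      using m(1) by (auto simp: X_def)
  qed
  have Xab: "\<not> X a b"
  proof
    assume "X a b"
    then obtain m where "m \<in> H" "m q = h q" "m p = h p"
      by (auto simp: X_def a_def pb)
    then show False
      using disagree P_eq by blast
  qed
  have Xaa: "X a a" and Xbb: "X b b" and Xcc: "X c c"
    using hp hp_p hp_other[OF q] hq pb p k2(1) k2_p k2_q
    by (auto simp: X_def N_def a_def b_def)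
  have step1: "\<not> X a y" if "y \<noteq> a" for y
  proof
    assume "X a y"
    moreover have "y \<noteq> b"
      using Xab \<open>X a y\<close> by blast
    ultimately show False
      using X_sel[OF _ Xbb, of a y] that Xab by (auto simp: doubleton_eq_iff)
  qed
  have step2: "\<not> X x y" if "y \<noteq> a" "x \<noteq> y" for x y
  proof
    assume "X x y"
    moreover from this have "x \<noteq> a"
      using step1 that by blast
    ultimately have "X a y"
      using X_sel[OF Xaa, of x y] that by (auto simp: doubleton_eq_iff)
    then show False
      using step1 that by blast
  qed
  have step3: "\<not> X x a" if "x \<noteq> a" for x
  proof
    assume X: "X x a"
    show False
    proof (cases "x = c")
      case True
      then have "X c b"
        using X_sel[OF X Xbb] B by (auto simp: doubleton_eq_iff)
      then show False
        using step2[of b c] B by simp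
    next
      case False
      then have "X x c"
        using X_sel[OF X Xcc] that B by (auto simp: doubleton_eq_iff)
      then show False
        using step2[of c x] B False by simp
    qed
  qed
  have "k p = k q" if "k \<in> H" for k
  proof -
    have "X (k q) (k p)"
      using that by (auto simp: X_def)
    then show ?thesis
      using step2 step3 by metis
  qed
  then have "P \<in> pairs_id Q H"
    using P(1) p(2) unfolding pairs_id_def P_eq by blast
  then show False
    using loc_id P(3) by blast
qed

text \<open>The setting of a minimal disagreement after each coordinate has been translated such that
  the function to be matched becomes \<open>0\<close>.\<close>

locale critical_family =
  fixes K :: "('q \<Rightarrow> 'g::ab_group_add) set" and P :: "'q set"
  assumes sel: "\<And>k l T. k \<in> K \<Longrightarrow> l \<in> K
      \<Longrightarrow> \<exists>m\<in>K. \<forall>q\<in>P. m q = (if k q - l q \<in> T then k q else l q)"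
    and nonzero: "\<And>k. k \<in> K \<Longrightarrow> \<exists>q\<in>P. k q \<noteq> 0"
    and almost: "\<And>q. q \<in> P \<Longrightarrow> \<exists>k\<in>K. \<forall>p\<in>P - {q}. k p = 0"
    and zero_at: "\<And>q. q \<in> P \<Longrightarrow> \<exists>k\<in>K. k q = 0"
    and nonempty: "P \<noteq> {}"
begin

definition spike :: "'q \<Rightarrow> ('q \<Rightarrow> 'g) \<Rightarrow> bool" where
  "spike q k \<longleftrightarrow> k \<in> K \<and> (\<forall>p\<in>P - {q}. k p = 0)"

lemma ex_spike: "q \<in> P \<Longrightarrow> \<exists>k. spike q k"
  using almost by (auto simp: spike_def)

lemma spike_in: "spike q k \<Longrightarrow> k \<in> K"
  by (simp add: spike_def)

lemma spike_other: "spike q k \<Longrightarrow> p \<in> P \<Longrightarrow> p \<noteq> q \<Longrightarrow> k p = 0"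
  by (simp add: spike_def)

lemma spike_nonzero: "spike q k \<Longrightarrow> k q \<noteq> 0"
  using nonzero[of k] by (auto simp: spike_def)

text \<open>A member vanishing at \<open>q\<close> must be nonzero at some other coordinate.\<close>

lemma ex_other: "q \<in> P \<Longrightarrow> \<exists>p\<in>P. p \<noteq> q"
  by (metis nonzero zero_at)

text \<open>The difference \<open>k - l\<close> is \<open>k p\<close> at \<open>p\<close> and
  \<open>- l q\<close> at \<open>q\<close>. Were these distinct, a selection could take
  \<open>l\<close> at \<open>p\<close> and \<open>k\<close> at \<open>q\<close>, producing zero
  everywhere.\<close>

lemma spikes_opposite:
  assumes "p \<in> P" "q \<in> P" "p \<noteq> q" "spike p k" "spike q l"
  shows "k p = - l q"
proof (rule ccontr)
  assume ne: "k p \<noteq> - l q"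
  obtain m where m: "m \<in> K" "\<forall>r\<in>P. m r = (if k r - l r \<in> {- l q} then k r else l r)"
    using sel[of k l "{- l q}"] assms(4,5) spike_in by blast
  have "m r = 0" if "r \<in> P" for r
    using m(2) that ne assms(1-3) spike_other[OF assms(4), of r] spike_other[OF assms(5), of r]
    by (cases "r = p"; cases "r = q") auto
  then show False
    using nonzero[OF m(1)] by blast
qed

definition values_at :: "'q \<Rightarrow> 'q \<Rightarrow> 'g \<Rightarrow> 'g \<Rightarrow> bool" where
  "values_at p q x y \<longleftrightarrow> (\<exists>m\<in>K. m p = x \<and> m q = y)"

lemma values_at_sel:
  assumes "p \<in> P" "q \<in> P" "values_at p q x y" "values_at p q x' y'" "x - x' \<noteq> y - y'"
  shows "values_at p q x y'"
proof -
  obtain k l where kl: "k \<in> K" "k p = x" "k q = y" "l \<in> K" "l p = x'" "l q = y'"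
    using assms(3,4) by (auto simp: values_at_def)
  obtain m where m: "m \<in> K" "\<forall>s\<in>P. m s = (if k s - l s \<in> {x - x'} then k s else l s)"
    using sel[of k l "{x - x'}"] kl by blast
  have "m p = x" "m q = y'"
    using m(2) kl assms by auto
  then show ?thesis
    using m(1) by (auto simp: values_at_def)
qed

end

section \<open>Critical families over Z3\<close>

lemma Z3_exhaust: "(x::3) = 0 \<or> x = 1 \<or> x = 2"
proof -
  have "card {0, 1, 2::3} = CARD(3)"
    by simp
  then have "{0, 1, 2::3} = UNIV"
    by (metis card_subset_eq finite subset_UNIV)
  then show ?thesis
    by blast
qed

lemma Z3_cases: "(d::3) \<noteq> 0 \<Longrightarrow> x = 0 \<or> x = d \<or> x = - d"
  using Z3_exhaust[of d] Z3_exhaust[of x] by auto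

lemma Z3_double: "(d::3) + d = - d"
  using Z3_exhaust[of d] by auto

lemma Z3_neg: "(d::3) \<noteq> 0 \<Longrightarrow> - d \<noteq> d"
  using Z3_exhaust[of d] by auto

text \<open>The three elements sum to 0, and twice \<open>j\<close> is \<open>- j\<close>. This
  makes \<open>R_up\<close> equality of differences.\<close>

lemma Z3_distinct: "i \<noteq> j \<Longrightarrow> j \<noteq> k \<Longrightarrow> i \<noteq> k \<Longrightarrow> (i::3) - j = j - k"
  using Z3_exhaust[of i] Z3_exhaust[of j] Z3_exhaust[of k] by auto

text \<open>A third coordinate would need a deviation opposite to both \<open>d\<close> and
  \<open>- d\<close>. On two coordinates the value pairs lie on a translation line or on the cross
  of a column and a row.\<close>

lemma critical_family_Z3:
  fixes K :: "('q \<Rightarrow> 3) set"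
  assumes "critical_family K P"
  obtains p q d where "P = {p, q}" "p \<noteq> q"
    "(\<forall>m\<in>K. m q = m p - d) \<or> (\<forall>m\<in>K. m p = d \<or> m q = - d)"
proof -
  interpret critical_family K P
    by (rule assms)
  obtain p where p: "p \<in> P"
    using nonempty by blast
  obtain q where q: "q \<in> P" "q \<noteq> p"
    using ex_other[OF p] by blast
  obtain k l where k: "spike p k" and l: "spike q l"
    using ex_spike p q by blast
  define d where "d = k p"
  have d: "d \<noteq> 0"
    using spike_nonzero[OF k] by (simp add: d_def)
  have spike_q: "m q = - d" if "spike q m" for m
    using spikes_opposite[OF q(1) p q(2) that k] by (simp add: d_def)
  have spike_p: "m p = d" if "spike p m" for m
    using spikes_opposite[OF p q(1) q(2)[symmetric] that l] spike_q[OF l] by simp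
  have P: "P = {p, q}"
  proof (rule ccontr)
    assume "P \<noteq> {p, q}"
    then obtain r where r: "r \<in> P" "r \<noteq> p" "r \<noteq> q"
      using p q by blast
    obtain m where m: "spike r m"
      using ex_spike[OF r(1)] by blast
    have "m r = - d" "m r = d"
      using spikes_opposite[OF r(1) p r(2) m k] spikes_opposite[OF r(1) q(1) r(3) m l]
        spike_q[OF l] by (simp_all add: d_def)
    then show False
      using Z3_neg[OF d] by simp
  qed
  define X where "X = values_at p q"
  have X_sel: "X x y'" if "X x y" "X x' y'" "x - x' \<noteq> y - y'" for x y x' y'
    using values_at_sel[OF p q(1)] that unfolding X_def by blast
  have Xp: "X d 0" and Xq: "X 0 (- d)"
    using spike_in[OF k] spike_other[OF k q] spike_in[OF l] spike_other[OF l p] q spike_q[OF l]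
    by (auto simp: X_def values_at_def d_def)
  have X0y: "y = - d" if "X 0 y" for y
  proof -
    obtain m where "m \<in> K" "m p = 0" "m q = y"
      using \<open>X 0 y\<close> by (auto simp: X_def values_at_def)
    moreover from this have "spike q m"
      unfolding spike_def using P by blast
    ultimately show ?thesis
      using spike_q[of m] by simp
  qed
  have Xx0: "x = d" if "X x 0" for x
  proof -
    obtain m where "m \<in> K" "m p = x" "m q = 0"
      using \<open>X x 0\<close> by (auto simp: X_def values_at_def)
    moreover from this have "spike p m"
      unfolding spike_def using P by blast
    ultimately show ?thesis
      using spike_p[of m] by simp
  qed
  have ddd: "d + d = - d" "- d - d = d" "- d \<noteq> d"
    using Z3_double[of d] Z3_double[of "- d"] Z3_neg[OF d] by simp_all
  have X_mem: "X (m p) (m q)" if "m \<in> K" for m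
    using that by (auto simp: X_def values_at_def)
  have no_dd: "\<not> X d d"
  proof
    assume "X d d"
    from X_sel[OF Xq this] have "X 0 d"
      using ddd d by auto
    then show False
      using X0y[of d] ddd(3) by simp
  qed
  \<comment> \<open>The only pair off the cross that can occur is \<open>(- d, d)\<close>. It lies
    on the line, and splicing with it and the two spikes rules out every pair off the line.\<close>
  have "(\<forall>m\<in>K. m q = m p - d) \<or> (\<forall>m\<in>K. m p = d \<or> m q = - d)"
  proof (rule disjCI)
    assume "\<not> (\<forall>m\<in>K. m p = d \<or> m q = - d)"
    then obtain m where m: "m \<in> K" "m p \<noteq> d" "m q \<noteq> - d"
      by blast
    have "m p \<noteq> 0" "m q \<noteq> 0"
      using X_mem[OF m(1)] X0y Xx0 m by auto
    then have "m p = - d" "m q = d"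
      using Z3_cases[OF d, of "m p"] Z3_cases[OF d, of "m q"] m by auto
    then have anti: "X (- d) d"
      using X_mem[OF m(1)] by simp
    have no_d_neg: "\<not> X d (- d)"
    proof
      assume "X d (- d)"
      from X_sel[OF this anti] have "X d d"
        using ddd by simp
      then show False
        using no_dd by simp
    qed
    have no_neg_neg: "\<not> X (- d) (- d)"
    proof
      assume "X (- d) (- d)"
      from X_sel[OF this Xp] have "X (- d) 0"
        using ddd by simp
      then show False
        using Xx0[of "- d"] ddd(3) by blast
    qed
    show "\<forall>m\<in>K. m q = m p - d"
    proof
      fix m assume "m \<in> K"
      then have X: "X (m p) (m q)"
        by (rule X_mem)
      consider "m p = 0" | "m p = d" | "m p = - d"
        using Z3_cases[OF d] by blast
      then show "m q = m p - d"
      proof cases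
        case 1
        then show ?thesis
          using X0y X by simp
      next
        case 2
        then show ?thesis
          using X no_dd no_d_neg Z3_cases[OF d, of "m q"] by auto
      next
        case 3
        then have "m q \<noteq> 0" "m q \<noteq> - d"
          using X Xx0[of "- d"] no_neg_neg ddd(3) by metis+
        then have "m q = d"
          using Z3_cases[OF d, of "m q"] by blast
        then show ?thesis
          unfolding 3 ddd(2) .
      qed
    qed
  qed
  then show ?thesis
    using that P q(2) by blast
qed

section \<open>Critical families over Z2 x Z2\<close>

lemma V4_add_self: "(x :: bit \<times> bit) + x = 0"
  by (cases x) (simp add: zero_prod_def)

lemma V4_minus: "- (x :: bit \<times> bit) = x"
  by (metis V4_add_self add.inverse_unique)

lemma V4_diff: "(x :: bit \<times> bit) - y = x + y"
  by (metis V4_minus diff_conv_add_uminus)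

lemma V4_exhaust: "x = (0, 0) \<or> x = (0, 1) \<or> x = (1, 0) \<or> x = (1, 1)" for x :: "bit \<times> bit"
proof -
  have "y = 0 \<or> y = 1" for y :: bit
    by (cases y) auto
  then show ?thesis
    by (metis surj_pair)
qed

lemma UNIV_V4: "(UNIV :: (bit \<times> bit) set) = {(0, 0), (0, 1), (1, 0), (1, 1)}"
  using V4_exhaust by blast

text \<open>The four elements sum to 0 and subtraction is addition.\<close>

lemma V4_distinct:
  assumes "distinct [i, j, k, l]"
  shows "(i :: bit \<times> bit) - j = k - l"
  using V4_exhaust[of i] V4_exhaust[of j] V4_exhaust[of k] V4_exhaust[of l] assms
  by (elim disjE) simp_all

text \<open>Here opposite means equal, so all spikes have the same height \<open>d\<close>. The
  assumption \<open>large\<close> says that some coordinate has at least three values; it excludes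
  families such as \<open>(d, 0)\<close>, \<open>(0, d)\<close>, \<open>(d, d)\<close>, which lie on
  no translation line.\<close>

lemma critical_family_V4:
  fixes K :: "('q \<Rightarrow> bit \<times> bit) set"
  assumes "critical_family K P"
    and large: "\<exists>q\<in>P. \<forall>d. \<exists>k\<in>K. k q \<notin> {0, d}"
  obtains p q d where "P = {p, q}" "p \<noteq> q" "\<forall>m\<in>K. m q = m p - d"
proof -
  interpret critical_family K P
    by (rule assms)
  have spikes_eq: "k p = l q" if "p \<in> P" "q \<in> P" "p \<noteq> q" "spike p k" "spike q l" for p q k l
    using spikes_opposite[OF that] by (simp add: V4_minus)
  obtain q where q: "q \<in> P" "\<forall>d. \<exists>k\<in>K. k q \<notin> {0, d}"
    using large by blast
  obtain hq where hq: "spike q hq"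
    using ex_spike q by blast
  define d where "d = hq q"
  have spike_d: "m r = d" if r: "r \<in> P" and m: "spike r m" for r m
  proof (cases "r = q")
    case False
    then show ?thesis
      using spikes_eq[OF r q(1) _ m hq] by (simp add: d_def)
  next
    case True
    obtain s l where s: "s \<in> P" "s \<noteq> q" "spike s l"
      using ex_other[OF q(1)] ex_spike by blast
    then show ?thesis
      using spikes_eq[of s q l m] spikes_eq[of s q l hq] q hq m True by (simp add: d_def)
  qed
  have d: "d \<noteq> 0"
    using spike_nonzero[OF hq] by (simp add: d_def)
  obtain k where k: "k \<in> K" "k q \<noteq> 0" "k q \<noteq> d"
    using q(2) by blast
  define c where "c = k q"
  have c: "c \<noteq> 0" "c \<noteq> d"
    using k by (simp_all add: c_def)
  have cd: "c + d \<noteq> 0" "c + d \<noteq> c" "c + d \<noteq> d" "c + d + d = c" "c + (c + d) = d"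
    using c d V4_add_self[of d] V4_add_self[of c] V4_minus[of d]
    by (auto simp: add.assoc eq_neg_iff_add_eq_0[symmetric])
  \<comment> \<open>The difference at \<open>q\<close> is \<open>c - d\<close>, that is
    \<open>c + d\<close>; elsewhere \<open>hq\<close> is 0, so \<open>k1\<close> can only be 0 or
    \<open>c + d\<close> there.\<close>
  obtain k1 where k1: "k1 \<in> K"
      "\<forall>r\<in>P. k1 r = (if k r - hq r \<in> {c + d} then k r else hq r)"
    using sel[OF k(1) spike_in[OF hq]] by blast
  have k1_q: "k1 q = c"
    using k1(2) q(1) by (simp add: c_def d_def V4_diff)
  have k1_other: "k1 r = 0 \<or> k1 r = c + d" if "r \<in> P" "r \<noteq> q" for r
    using k1(2) that spike_other[OF hq that] by simp
  have "\<not> spike q k1"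
    using spike_d[OF q(1)] k1_q c by auto
  then obtain p where p: "p \<in> P" "p \<noteq> q" "k1 p \<noteq> 0"
    using k1(1) by (auto simp: spike_def)
  then have k1_p: "k1 p = c + d"
    using k1_other by blast
  obtain hp where hp: "spike p hp"
    using ex_spike p(1) by blast
  \<comment> \<open>At \<open>p\<close> the difference is \<open>(c + d) - d = c\<close>, as at
    \<open>q\<close>; elsewhere it is 0 or \<open>c + d\<close>, so \<open>k2\<close> vanishes
    outside \<open>p\<close> and \<open>q\<close>.\<close>
  obtain k2 where k2: "k2 \<in> K" "\<forall>r\<in>P. k2 r = (if k1 r - hp r \<in> {c} then k1 r else hp r)"
    using sel[OF k1(1) spike_in[OF hp]] by blast
  have k2_q: "k2 q = c"
    using k2(2) q(1) k1_q spike_other[OF hp q(1)] p(2) by simp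
  have k2_p: "k2 p = c + d"
    using k2(2) p(1) k1_p spike_d[OF p(1) hp] by simp
  have k2_other: "k2 r = 0" if "r \<in> P" "r \<noteq> p" "r \<noteq> q" for r
    using k2(2) that k1_other[of r] spike_other[OF hp that(1,2)] c cd by auto
  have P: "P = {p, q}"
  proof (rule ccontr)
    assume "P \<noteq> {p, q}"
    then obtain r where r: "r \<in> P" "r \<noteq> p" "r \<noteq> q"
      using p q by blast
    obtain hr where hr: "spike r hr"
      using ex_spike r(1) by blast
    have hr_r: "hr r = d"
      by (rule spike_d[OF r(1) hr])
    \<comment> \<open>The differences are \<open>c\<close> at \<open>q\<close>, \<open>d\<close> at
      \<open>r\<close> and \<open>c + d\<close> at \<open>p\<close>, so \<open>m\<close> is a spike
      at \<open>p\<close> of the wrong height \<open>c + d\<close>.\<close>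
    obtain m where m: "m \<in> K"
        "\<forall>s\<in>P. m s = (if k2 s - hr s \<in> {c + d, d} then k2 s else hr s)"
      using sel[OF k2(1) spike_in[OF hr]] by blast
    have "m s = 0" if s: "s \<in> P" "s \<noteq> p" for s
    proof -
      consider "s = q" | "s = r" | "s \<noteq> q" "s \<noteq> r"
        by blast
      then show ?thesis
      proof cases
        case 1
        then show ?thesis
          using m(2) s spike_other[OF hr s(1)] r k2_q cd c by auto
      next
        case 2
        then show ?thesis
          using m(2) s hr_r k2_other[OF r] by (simp add: V4_diff)
      next
        case 3
        then show ?thesis
          using m(2) s spike_other[OF hr s(1)] k2_other[OF s] by simp
      qed
    qed
    then have "spike p m"
      using m(1) by (simp add: spike_def)
    moreover have "m p = c + d"
      using m(2) p(1) k2_p spike_other[OF hr p(1)] r by auto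
    ultimately show False
      using spike_d[OF p(1)] cd by auto
  qed
  define X where "X = values_at p q"
  have X_sel: "X x y'" if "X x y" "X x' y'" "x - x' \<noteq> y - y'" for x y x' y'
    using values_at_sel[OF p(1) q(1)] that unfolding X_def by blast
  have Xp: "X d 0" and Xq: "X 0 d" and Xc: "X (c + d) c"
    using spike_in[OF hp] spike_d[OF p(1) hp] spike_other[OF hp q(1)]
      spike_in[OF hq] spike_d[OF q(1) hq] spike_other[OF hq p(1)] p(2) k2(1) k2_p k2_q
    by (auto simp: X_def values_at_def)
  have X0y: "y = d" if "X 0 y" for y
  proof -
    obtain m where "m \<in> K" "m p = 0" "m q = y"
      using \<open>X 0 y\<close> by (auto simp: X_def values_at_def)
    moreover from this have "spike q m"
      unfolding spike_def using P by blast
    ultimately show ?thesis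
      using spike_d[OF q(1), of m] by simp
  qed
  have Xx0: "x = d" if "X x 0" for x
  proof -
    obtain m where "m \<in> K" "m p = x" "m q = 0"
      using \<open>X x 0\<close> by (auto simp: X_def values_at_def)
    moreover from this have "spike p m"
      unfolding spike_def using P by blast
    ultimately show ?thesis
      using spike_d[OF p(1), of m] by simp
  qed
  have X_cases: "y = x + d \<or> x = d \<and> y = d" if X: "X x y" for x y
  proof (rule disjCI)
    assume ne: "\<not> (x = d \<and> y = d)"
    show "y = x + d"
    proof (rule ccontr)
      assume neq: "y \<noteq> x + d"
      have neq': "x \<noteq> y + d"
        using neq V4_add_self[of d] by (auto simp: add.assoc)
      have "X 0 y"
        by (rule X_sel[OF Xq X]) (use neq' in \<open>simp add: V4_diff add.commute\<close>)
      moreover have "X x 0"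
        by (rule X_sel[OF X Xp]) (use neq in \<open>simp add: V4_diff eq_commute\<close>)
      ultimately show False
        using X0y Xx0 ne by blast
    qed
  qed
  \<comment> \<open>The one pair off the line that survives splicing with the two spikes is excluded
    by the pair \<open>(c + d, c)\<close>, which \<open>k2\<close> provides.\<close>
  have no_dd: "\<not> X d d"
  proof
    assume "X d d"
    from X_sel[OF this Xc] have "X d c"
      using cd c by (auto simp: V4_diff add.commute add.left_commute)
    then show False
      using X_cases[of d c] c V4_add_self[of d] by auto
  qed
  have "m q = m p - d" if "m \<in> K" for m
  proof -
    have "X (m p) (m q)"
      using that by (auto simp: X_def values_at_def)
    then show ?thesis
      using X_cases no_dd by (metis V4_diff)
  qed
  then show ?thesis
    using that P p(2) by blast
qed

section \<open>Decomposability\<close>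

context sym_cons_clone
begin

section \<open>Invariance from closure on the pieces\<close>

lemma op_in:
  assumes "(length hs, f) \<in> F" "set hs \<subseteq> H" "H \<subseteq> Q \<rightarrow>\<^sub>E A" "q \<in> Q"
  shows "\<exists>h\<in>set hs. f (map (\<lambda>h. h q) hs) = h q"
proof -
  have "h q \<in> A" if "h \<in> set hs" for h
    using PiE_mem[OF subsetD[OF assms(3)] assms(4)] assms(2) that by blast
  then have "map (\<lambda>h. h q) hs \<in> tuples A (length hs)"
    by (auto simp: tuples_def)
  from cons_op[OF assms(1) this] show ?thesis
    by auto
qed

lemma closed_on_singleton:
  assumes "H \<subseteq> Q \<rightarrow>\<^sub>E A" "q \<in> Q"
  shows "closed_on F H {q}"
  unfolding closed_on_def agrees_on_def
proof (intro allI impI)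
  fix f hs assume f: "(length hs, f) \<in> F" "set hs \<subseteq> H"
  obtain h where "h \<in> set hs" "f (map (\<lambda>h. h q) hs) = h q"
    using op_in[OF f assms] by blast
  then show "\<exists>k\<in>H. \<forall>r\<in>{q}. k r = f (map (\<lambda>h. h r) hs)"
    using f(2) by (intro bexI[of _ h]) auto
qed

lemma closed_on_pairs_id:
  assumes "H \<subseteq> Q \<rightarrow>\<^sub>E A" "R \<in> pairs_id Q H"
  shows "closed_on F H R"
  unfolding closed_on_def agrees_on_def
proof (intro allI impI)
  fix f hs assume f: "(length hs, f) \<in> F" "set hs \<subseteq> H"
  obtain p q where R: "R = {p, q}" "p \<in> Q" "q \<in> Q" "\<forall>h\<in>H. h p = h q"
    using assms(2) by (auto simp: pairs_id_def)
  obtain h where h: "h \<in> set hs" "f (map (\<lambda>h. h p) hs) = h p"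
    using op_in[OF f assms(1) R(2)] by blast
  have "map (\<lambda>h. h q) hs = map (\<lambda>h. h p) hs"
    using R(4) f(2) by (intro map_cong) (metis subsetD)+
  then have "f (map (\<lambda>h. h q) hs) = h p"
    using h(2) by metis
  moreover have "h p = h q"
    using h(1) R(4) f(2) by blast
  ultimately have "f (map (\<lambda>h. h q) hs) = h q"
    by simp
  then show "\<exists>k\<in>H. \<forall>r\<in>R. k r = f (map (\<lambda>h. h r) hs)"
    using f(2) h R(1) by (intro bexI[of _ h]) auto
qed

text \<open>An operation applied to members of \<open>H\<close> gives a function matched on every
  piece, hence a member by decomposability. Conservativity keeps its values in
  \<open>A\<close>.\<close>

lemma Inv_if_decomposable:
  assumes H: "H \<subseteq> Q \<rightarrow>\<^sub>E A" and dec: "decomposable A Q H \<R>" and "\<R> \<noteq> {}"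
    and closed: "\<And>R. R \<in> \<R> \<Longrightarrow> R \<subseteq> Q \<and> closed_on F H R"
  shows "H \<in> Inv A Q F"
  unfolding in_Inv_iff[OF H] closed_on_def
proof (intro allI impI)
  fix f hs assume f: "(length hs, f) \<in> F" "set hs \<subseteq> H"
  define g where "g = restrict (\<lambda>q. f (map (\<lambda>h. h q) hs)) Q"
  have "f (map (\<lambda>h. h q) hs) \<in> A" if q: "q \<in> Q" for q
  proof -
    obtain h where "h \<in> set hs" "f (map (\<lambda>h. h q) hs) = h q"
      using op_in[OF f H q] by blast
    moreover from this have "h \<in> Q \<rightarrow>\<^sub>E A"
      using f(2) H by auto
    ultimately show ?thesis
      using PiE_mem[OF _ q] by metis
  qed
  then have g: "g \<in> Q \<rightarrow>\<^sub>E A"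
    by (simp add: g_def)
  have "agrees_on H g R" if "R \<in> \<R>" for R
  proof -
    have "agrees_on H (\<lambda>q. f (map (\<lambda>h. h q) hs)) R" "R \<subseteq> Q"
      using closed[OF that] f by (auto simp: closed_on_def)
    then show ?thesis
      by (auto simp: agrees_on_def g_def subset_iff)
  qed
  then have "g \<in> H"
    using dec g unfolding decomposable_iff[OF H \<open>\<R> \<noteq> {}\<close>] by blast
  then show "agrees_on H (\<lambda>q. f (map (\<lambda>h. h q) hs)) Q"
    unfolding agrees_on_def by (intro bexI[of _ g]) (simp_all add: g_def)
qed

lemma decomposable_if_agrees:
  assumes "H \<subseteq> Q \<rightarrow>\<^sub>E A" "\<R> \<noteq> {}"
    and "\<And>h. h \<in> Q \<rightarrow>\<^sub>E A \<Longrightarrow> \<forall>R\<in>\<R>. agrees_on H h R \<Longrightarrow> agrees_on H h Q"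
  shows "decomposable A Q H \<R>"
  using assms(3) unfolding decomposable_iff[OF assms(1,2)] by (metis agrees_on_whole[OF assms(1)])

section \<open>Decomposability of invariant sets\<close>

lemma decomposable_generic:
  assumes inv: "H \<in> Inv A Q F" and fin_Q: "finite Q" and ne: "Q \<noteq> {}" "H \<noteq> {}"
    and sim_range: "\<And>a b c d. (a, b) \<approx> (c, d) \<Longrightarrow> {a, b} = {c, d}"
  shows "decomposable A Q H
    (singletons Q \<union> pairs_id Q H \<union> {QB Q H B | B. B \<in> ksubsets A 2})"
proof -
  have H: "H \<subseteq> Q \<rightarrow>\<^sub>E A"
    using inv by (simp add: Inv_def)
  show ?thesis
  proof (rule decomposable_if_agrees[OF H])
    fix h assume h: "h \<in> Q \<rightarrow>\<^sub>E A"
      and loc: "\<forall>R\<in>singletons Q \<union> pairs_id Q H \<union> {QB Q H B | B. B \<in> ksubsets A 2}.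
        agrees_on H h R"
    show "agrees_on H h Q"
    proof (rule agrees_on_if_locally_agrees[OF fin_Q ne(2) H h])
      fix k l \<S> assume "k \<in> H" "l \<in> H"
      then show "\<exists>m\<in>H. \<forall>q\<in>Q. m q = (if {k q, l q} \<in> \<S> then k q else l q)"
        by (rule Inv_selection[OF inv]) (metis sim_range)
    qed (use loc in \<open>auto simp: singletons_def\<close>)
  qed (use ne in \<open>auto simp: singletons_def\<close>)
qed

lemma critical_family_translate:
  fixes e :: "'a \<Rightarrow> 'g::ab_group_add"
  assumes inv: "H \<in> Inv A Q F" and h: "h \<in> Q \<rightarrow>\<^sub>E A"
    and e: "inj_on e A"
    and sim_diff: "\<And>a b c d. (a, b) \<approx> (c, d) \<Longrightarrow> e a - e b = e c - e d"
    and loc: "\<And>q. q \<in> Q \<Longrightarrow> agrees_on H h {q}"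
    and P: "P \<subseteq> Q" "P \<noteq> {}" "\<not> agrees_on H h P" "\<forall>q\<in>P. agrees_on H h (P - {q})"
  shows "critical_family ((\<lambda>k q. e (k q) - e (h q)) ` H) P"
proof
  fix k l T
  assume "k \<in> (\<lambda>k q. e (k q) - e (h q)) ` H" "l \<in> (\<lambda>k q. e (k q) - e (h q)) ` H"
  then obtain k' l' where kl: "k' \<in> H" "k = (\<lambda>q. e (k' q) - e (h q))"
      "l' \<in> H" "l = (\<lambda>q. e (l' q) - e (h q))"
    by blast
  \<comment> \<open>The translation by \<open>e (h q)\<close> cancels in \<open>k q - l q\<close>,
    so selecting by differences is the same before and after it.\<close>
  have "\<exists>m\<in>H. \<forall>q\<in>Q. m q = (if e (k' q) - e (l' q) \<in> T then k' q else l' q)"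
    by (rule Inv_selection[OF inv kl(1,3)]) (metis sim_diff)
  then obtain m where m: "m \<in> H"
      "\<And>q. q \<in> Q \<Longrightarrow> m q = (if e (k' q) - e (l' q) \<in> T then k' q else l' q)"
    by blast
  then have "\<forall>q\<in>P. e (m q) - e (h q) = (if k q - l q \<in> T then k q else l q)"
    using P(1) by (auto simp: kl(2,4))
  then show "\<exists>m\<in>(\<lambda>k q. e (k q) - e (h q)) ` H. \<forall>q\<in>P. m q = (if k q - l q \<in> T then k q else l q)"
    using m(1) by (intro bexI[of _ "\<lambda>q. e (m q) - e (h q)"]) auto
next
  have H: "H \<subseteq> Q \<rightarrow>\<^sub>E A"
    using inv by (simp add: Inv_def)
  fix k assume "k \<in> (\<lambda>k q. e (k q) - e (h q)) ` H"
  then obtain k' where k': "k' \<in> H" "k = (\<lambda>q. e (k' q) - e (h q))"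
    by blast
  then obtain q where q: "q \<in> P" "k' q \<noteq> h q"
    using P(3) by (auto simp: agrees_on_def)
  moreover have "k' q \<in> A" "h q \<in> A"
    using PiE_mem[of k' Q "\<lambda>_. A" q] PiE_mem[OF h, of q] k'(1) H q(1) P(1) by auto
  ultimately have "e (k' q) \<noteq> e (h q)"
    using e by (simp add: inj_on_eq_iff)
  then show "\<exists>q\<in>P. k q \<noteq> 0"
    using q(1) k'(2) by auto
next
  fix q assume q: "q \<in> P"
  obtain k where "k \<in> H" "\<forall>p\<in>P - {q}. k p = h p"
    using P(4) q by (auto simp: agrees_on_def)
  then show "\<exists>k\<in>(\<lambda>k q. e (k q) - e (h q)) ` H. \<forall>p\<in>P - {q}. k p = 0"
    by (intro bexI[of _ "\<lambda>q. e (k q) - e (h q)"]) auto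
  obtain l where "l \<in> H" "l q = h q"
    using loc[of q] q P(1) by (auto simp: agrees_on_def)
  then show "\<exists>k\<in>(\<lambda>k q. e (k q) - e (h q)) ` H. k q = 0"
    by (intro bexI[of _ "\<lambda>q. e (l q) - e (h q)"]) auto
qed (use P in auto)

text \<open>Surjectivity of \<open>e\<close> pulls translation by \<open>c\<close> back to a
  permutation of \<open>A\<close>.\<close>

lemma pairs0_if_translation:
  fixes e :: "'a \<Rightarrow> 'g::ab_group_add"
  assumes e: "bij_betw e A UNIV" and H: "H \<subseteq> Q \<rightarrow>\<^sub>E A"
    and pq: "p \<in> Q" "q \<in> Q" "p \<noteq> q" and trans: "\<forall>k\<in>H. e (k q) = e (k p) + c"
  shows "{p, q} \<in> pairs0 A Q H"
proof -
  define \<sigma> where "\<sigma> x = (if x \<in> A then inv_into A e (e x + c) else x)" for x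
  have e_inv: "inv_into A e y \<in> A" "e (inv_into A e y) = y" for y
    using e by (auto simp: bij_betw_def inv_into_into f_inv_into_f)
  have inj_e: "inj_on e A"
    using e by (simp add: bij_betw_def)
  have "inj_on \<sigma> A"
  proof (rule inj_onI)
    fix x y assume xy: "x \<in> A" "y \<in> A" "\<sigma> x = \<sigma> y"
    then have "e (inv_into A e (e x + c)) = e (inv_into A e (e y + c))"
      by (simp add: \<sigma>_def)
    then show "x = y"
      using inj_onD[OF inj_e _ xy(1,2)] by (simp add: e_inv)
  qed
  moreover have "\<sigma> ` A \<subseteq> A"
    by (auto simp: \<sigma>_def e_inv)
  ultimately have "bij_betw \<sigma> A A"
    using fin by (simp add: bij_betw_def endo_inj_surj)
  then have "\<sigma> permutes A"
    by (rule bij_imp_permutes) (simp add: \<sigma>_def)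
  moreover have "k q = \<sigma> (k p)" if "k \<in> H" for k
  proof -
    have "k p \<in> A" "k q \<in> A"
      using PiE_mem[of k Q "\<lambda>_. A"] that H pq by auto
    moreover from this have "e (\<sigma> (k p)) = e (k q)"
      using trans that by (simp add: \<sigma>_def e_inv)
    moreover have "\<sigma> (k p) \<in> A"
      using \<open>k p \<in> A\<close> by (simp add: \<sigma>_def e_inv)
    ultimately show ?thesis
      using inj_onD[OF inj_e] by metis
  qed
  ultimately show ?thesis
    using pq unfolding pairs0_def by blast
qed

lemma decomposable_R_up:
  assumes inv: "H \<in> Inv A Q F" and fin_Q: "finite Q" and ne: "Q \<noteq> {}" "H \<noteq> {}"
    and card: "card A = 3" and sim: "R2star A F = R_up A"
  shows "decomposable A Q H (singletons Q \<union> pairs0 A Q H \<union> pairs1 A Q H)"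
proof -
  have H: "H \<subseteq> Q \<rightarrow>\<^sub>E A"
    using inv by (simp add: Inv_def)
  obtain e :: "'a \<Rightarrow> 3" where e: "bij_betw e A UNIV"
    using finite_same_card_bij[of A "UNIV :: 3 set"] fin card by auto
  then have inj_e: "inj_on e A"
    by (simp add: bij_betw_def)
  have e_inv: "inv_into A e y \<in> A" "e (inv_into A e y) = y" for y
    using e by (auto simp: bij_betw_def inv_into_into f_inv_into_f)
  have sim_diff: "e a - e b = e c - e d" if "(a, b) \<approx> (c, d)" for a b c d
  proof -
    have mem: "a \<in> A" "b \<in> A" "c \<in> A" "d \<in> A" "a \<noteq> b" "c \<noteq> d"
      using sim_mem[OF that] by auto
    have "(a, b) = (c, d) \<or> (b = c \<and> a \<noteq> d) \<or> (a = d \<and> b \<noteq> c)"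
      using that by (simp add: sim R_up_def)
    then show ?thesis
    proof (elim disjE conjE)
      assume "b = c" "a \<noteq> d"
      then show ?thesis
        using Z3_distinct[of "e a" "e b" "e d"] mem inj_onD[OF inj_e] by metis
    next
      assume "a = d" "b \<noteq> c"
      then show ?thesis
        using Z3_distinct[of "e c" "e a" "e b"] mem inj_onD[OF inj_e] by metis
    qed simp
  qed
  show ?thesis
  proof (rule decomposable_if_agrees[OF H])
    fix h assume h: "h \<in> Q \<rightarrow>\<^sub>E A"
      and loc: "\<forall>R\<in>singletons Q \<union> pairs0 A Q H \<union> pairs1 A Q H. agrees_on H h R"
    show "agrees_on H h Q"
    proof (rule ccontr)
      assume "\<not> agrees_on H h Q"
      from ex_minimal_disagreement[OF fin_Q ne(2) this]
      obtain P where P: "P \<subseteq> Q" "P \<noteq> {}" "\<not> agrees_on H h P"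
          "\<forall>q\<in>P. agrees_on H h (P - {q})"
        by auto
      have crit: "critical_family ((\<lambda>k q. e (k q) - e (h q)) ` H) P"
        by (rule critical_family_translate[OF inv h inj_e sim_diff _ P])
          (use loc in \<open>auto simp: singletons_def\<close>)
      obtain p q d where pq: "P = {p, q}" "p \<noteq> q"
        and alt_K: "(\<forall>m\<in>(\<lambda>k q. e (k q) - e (h q)) ` H. m q = m p - d)
          \<or> (\<forall>m\<in>(\<lambda>k q. e (k q) - e (h q)) ` H. m p = d \<or> m q = - d)"
        by (rule critical_family_Z3[OF crit])
      have alt: "(\<forall>k\<in>H. e (k q) - e (h q) = e (k p) - e (h p) - d)
          \<or> (\<forall>k\<in>H. e (k p) - e (h p) = d \<or> e (k q) - e (h q) = - d)"
        using alt_K unfolding ball_simps(9) .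
      have PQ: "p \<in> Q" "q \<in> Q"
        using P(1) pq(1) by auto
      have "P \<in> pairs0 A Q H \<union> pairs1 A Q H"
        using alt
      proof
        assume "\<forall>k\<in>H. e (k q) - e (h q) = e (k p) - e (h p) - d"
        then have "\<forall>k\<in>H. e (k q) = e (k p) + (e (h q) - e (h p) - d)"
          by (simp add: algebra_simps)
        then have "P \<in> pairs0 A Q H"
          unfolding pq(1) by (rule pairs0_if_translation[OF e H PQ pq(2)])
        then show ?thesis
          by blast
      next
        assume *: "\<forall>k\<in>H. e (k p) - e (h p) = d \<or> e (k q) - e (h q) = - d"
        \<comment> \<open>The two arms of the cross, translated back from deviations to values in
          \<open>A\<close>.\<close>
        define a where "a = inv_into A e (e (h p) + d)"
        define b where "b = inv_into A e (e (h q) - d)"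
        have ab: "a \<in> A" "b \<in> A" "e a = e (h p) + d" "e b = e (h q) - d"
          by (simp_all add: a_def b_def e_inv)
        have "k p = a \<or> k q = b" if k: "k \<in> H" for k
        proof -
          have "k p \<in> A" "k q \<in> A"
            using PiE_mem[of k Q "\<lambda>_. A"] k H PQ by auto
          moreover have "e (k p) = e a \<or> e (k q) = e b"
            using * k unfolding ab by (auto simp: algebra_simps)
          ultimately show ?thesis
            using inj_onD[OF inj_e] ab(1,2) by metis
        qed
        then have "\<exists>a\<in>A. \<exists>b\<in>A. \<forall>k\<in>H. k p = a \<or> k q = b"
          using ab(1,2) by (intro bexI[of _ a] bexI[of _ b] ballI)
        then have "P \<in> pairs1 A Q H"
          using PQ pq unfolding pairs1_def by blast
        then show ?thesis
          by blast
      qed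
      then show False
        using loc P(3) by blast
    qed
  qed (use ne in \<open>auto simp: singletons_def\<close>)
qed

lemma decomposable_R_pm:
  assumes inv: "H \<in> Inv A Q F" and fin_Q: "finite Q" and ne: "Q \<noteq> {}" "H \<noteq> {}"
    and card: "card A = 4" and sim: "R2star A F = R_pm A"
  shows "decomposable A Q H (singletons Q \<union> pairs0 A Q H \<union> {Q3 Q H})"
proof -
  have H: "H \<subseteq> Q \<rightarrow>\<^sub>E A"
    using inv by (simp add: Inv_def)
  have "card (UNIV :: (bit \<times> bit) set) = 4" "finite (UNIV :: (bit \<times> bit) set)"
    by (simp_all add: UNIV_V4)
  then obtain e :: "'a \<Rightarrow> bit \<times> bit" where e: "bij_betw e A UNIV"
    using finite_same_card_bij[of A "UNIV :: (bit \<times> bit) set"] fin card by auto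
  then have inj_e: "inj_on e A"
    by (simp add: bij_betw_def)
  have sim_diff: "e a - e b = e c - e d" if "(a, b) \<approx> (c, d)" for a b c d
  proof -
    have mem: "a \<in> A" "b \<in> A" "c \<in> A" "d \<in> A" "a \<noteq> b" "c \<noteq> d"
      using sim_mem[OF that] by auto
    have "{a, b} = {c, d} \<or> {a, b} \<inter> {c, d} = {}"
      using that by (simp add: sim R_pm_def)
    then show ?thesis
    proof
      assume "{a, b} = {c, d}"
      then show ?thesis
        by (auto simp: doubleton_eq_iff V4_diff add.commute)
    next
      assume "{a, b} \<inter> {c, d} = {}"
      then have "distinct (map e [a, b, c, d])"
        using mem inj_on_eq_iff[OF inj_e] by auto
      then show ?thesis
        using V4_distinct by simp
    qed
  qed
  show ?thesis
  proof (rule decomposable_if_agrees[OF H])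
    fix h assume h: "h \<in> Q \<rightarrow>\<^sub>E A"
      and loc: "\<forall>R\<in>singletons Q \<union> pairs0 A Q H \<union> {Q3 Q H}. agrees_on H h R"
    show "agrees_on H h Q"
    proof (rule ccontr)
      assume "\<not> agrees_on H h Q"
      from ex_minimal_disagreement[OF fin_Q ne(2) this]
      obtain P where P: "P \<subseteq> Q" "P \<noteq> {}" "\<not> agrees_on H h P"
          "\<forall>q\<in>P. agrees_on H h (P - {q})"
        by auto
      let ?K = "(\<lambda>k q. e (k q) - e (h q)) ` H"
      have crit: "critical_family ?K P"
        by (rule critical_family_translate[OF inv h inj_e sim_diff _ P])
          (use loc in \<open>auto simp: singletons_def\<close>)
      have "\<not> P \<subseteq> Q3 Q H"
        using P(3) loc agrees_on_mono by blast
      then obtain q where q: "q \<in> P" "q \<notin> Q3 Q H"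
        by blast
      then have "q \<in> Q"
        using P(1) by blast
      \<comment> \<open>If all deviations at \<open>q\<close> were 0 or \<open>d\<close>, then
        \<open>H\<close> would have at most two values at \<open>q\<close>, putting \<open>q\<close>
        into \<open>Q3 Q H\<close>.\<close>
      have "\<exists>k\<in>?K. k q \<notin> {0, d}" for d
      proof (rule ccontr)
        assume "\<not> (\<exists>k\<in>?K. k q \<notin> {0, d})"
        then have *: "e (k q) - e (h q) = 0 \<or> e (k q) - e (h q) = d" if "k \<in> H" for k
          using that by auto
        have "e (k q) \<in> {e (h q), e (h q) + d}" if "k \<in> H" for k
          using *[OF that] by (auto simp: algebra_simps)
        then have "e ` Hq H q \<subseteq> {e (h q), e (h q) + d}"
          unfolding Hq_def by blast
        then have "card (e ` Hq H q) \<le> card {e (h q), e (h q) + d}"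
          by (rule card_mono[rotated]) simp
        also have "\<dots> \<le> 2"
          by (simp add: card_insert_if)
        finally have "card (e ` Hq H q) \<le> 2" .
        moreover have "Hq H q \<subseteq> A"
          unfolding Hq_def using PiE_mem[OF subsetD[OF H] \<open>q \<in> Q\<close>] by blast
        then have "card (e ` Hq H q) = card (Hq H q)"
          by (rule card_image[OF inj_on_subset[OF inj_e]])
        ultimately show False
          using q(2) \<open>q \<in> Q\<close> by (simp add: Q3_def)
      qed
      then have large: "\<exists>q\<in>P. \<forall>d. \<exists>k\<in>?K. k q \<notin> {0, d}"
        using q(1) by blast
      obtain p q d where pq: "P = {p, q}" "p \<noteq> q"
        and "\<forall>m\<in>?K. m q = m p - d"
        by (rule critical_family_V4[OF crit large])
      then have "\<forall>k\<in>H. e (k q) - e (h q) = e (k p) - e (h p) - d"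
        by simp
      then have "\<forall>k\<in>H. e (k q) = e (k p) + (e (h q) - e (h p) - d)"
        by (simp add: algebra_simps)
      moreover have "p \<in> Q" "q \<in> Q"
        using P(1) pq(1) by auto
      ultimately have "P \<in> pairs0 A Q H"
        unfolding pq(1) using pairs0_if_translation[OF e H _ _ pq(2)] by blast
      then show False
        using loc P(3) by blast
    qed
  qed (use ne in \<open>auto simp: singletons_def\<close>)
qed

section \<open>Klein functions\<close>

text \<open>A tuple over \<open>{a, b}\<close> is the value of a tuple of binary projections at \<open>(a, b)\<close>, which
  reduces the action of \<open>f\<close> on such tuples to binary members.\<close>

lemma op_on_pair_equivariant:
  assumes f: "(n, f) \<in> F" and sim: "(a, b) \<approx> (\<tau> a, \<tau> b)" and xs: "xs \<in> tuples {a, b} n"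
  shows "f (map \<tau> xs) = \<tau> (f xs)"
proof -
  have mem: "a \<in> A" "b \<in> A" "\<tau> a \<in> A" "\<tau> b \<in> A" "a \<noteq> b" "\<tau> a \<noteq> \<tau> b"
    using sim_mem[OF sim] by auto
  obtain p where p: "(2, p) \<in> F" "\<And>x y. x \<in> A \<Longrightarrow> y \<in> A \<Longrightarrow> p [x, y] = x"
    using fst_op by blast
  obtain q where q: "(2, q) \<in> F" "\<And>x y. x \<in> A \<Longrightarrow> y \<in> A \<Longrightarrow> q [x, y] = y"
    using snd_op by blast
  define gs where "gs = map (\<lambda>x. if x = a then p else q) xs"
  define g where "g = restrict (\<lambda>ys. f (map (\<lambda>g. g ys) gs)) (tuples A 2)"
  have "(2, g) \<in> F"
    unfolding g_def by (rule comp_op[OF f]) (use xs p(1) q(1) in \<open>auto simp: gs_def tuples_def\<close>)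
  have set_xs: "set xs \<subseteq> {a, b}"
    using xs by (simp add: tuples_def)
  have "map (\<lambda>g. g [a, b]) gs = xs"
    unfolding gs_def map_map comp_def
    by (rule map_idI) (use set_xs p(2) q(2) mem in auto)
  then have g1: "g [a, b] = f xs"
    using mem by (simp add: g_def tuples_def)
  have "map (\<lambda>g. g [\<tau> a, \<tau> b]) gs = map \<tau> xs"
    unfolding gs_def map_map comp_def
    by (rule map_cong) (use set_xs p(2) q(2) mem in auto)
  then have g2: "g [\<tau> a, \<tau> b] = f (map \<tau> xs)"
    using mem by (simp add: g_def tuples_def)
  have "g [a, b] = a \<longleftrightarrow> g [\<tau> a, \<tau> b] = \<tau> a"
    using sim sim_sym[OF sim] \<open>(2, g) \<in> F\<close> by (auto simp: R2star_iff le_def)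
  then show ?thesis
    using binary_op_cases[OF \<open>(2, g) \<in> F\<close> mem(1,2)] binary_op_cases[OF \<open>(2, g) \<in> F\<close> mem(3,4)]
    unfolding g1 g2 by metis
qed

text \<open>A fixed-point-free involution maps a two-element set either to itself or to a disjoint
  one.\<close>

lemma sim_klein:
  assumes sim: "R2star A F = R_pm A" and "\<sigma> \<in> klein_group A" "a \<in> A" "b \<in> A" "a \<noteq> b"
  shows "(a, b) \<approx> (\<sigma> a, \<sigma> b)"
proof -
  have perm: "\<sigma> permutes A" and "\<sigma> = id \<or> (\<forall>x\<in>A. \<sigma> x \<noteq> x \<and> \<sigma> (\<sigma> x) = x)"
    using assms(2) by (auto simp: klein_group_def)
  then have "{a, b} = {\<sigma> a, \<sigma> b} \<or> {a, b} \<inter> {\<sigma> a, \<sigma> b} = {}"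
    using assms(3,4) by auto
  moreover have "\<sigma> a \<in> A" "\<sigma> b \<in> A" "\<sigma> a \<noteq> \<sigma> b"
    using perm assms(3-5) by (simp_all add: permutes_in_image inj_eq[OF permutes_inj])
  ultimately show ?thesis
    using assms(3-5) by (simp add: sim R_pm_def A22_iff)
qed

lemma op_klein_fun:
  assumes sim: "R2star A F = R_pm A" and f: "(n, f) \<in> F"
  shows "klein_fun A (Pi0 A F) n f"
  unfolding klein_fun_def
proof (intro conjI ballI impI)
  show "(n, f) \<in> ops A"
    using clone f by (auto simp: clone_def)
next
  fix B xs assume B: "B \<in> ksubsets A 2" and xs: "xs \<in> tuples B n"
  then have "xs \<in> tuples A n"
    by (auto simp: tuples_def ksubsets_def)
  then show "f xs \<in> B"
    using cons_op[OF f] xs by (auto simp: tuples_def)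
next
  fix B assume B: "B \<in> ksubsets A 2"
  then have "finite B" "card B = card {0, 1::nat}"
    by (auto simp: ksubsets_def)
  then obtain \<sigma> where \<sigma>: "bij_betw \<sigma> B {0, 1::nat}"
    using finite_same_card_bij by (metis finite.emptyI finite_insert)
  then have "(n, transport2 B \<sigma> n f) \<in> Pi0 A F"
    using B f unfolding Pi0_def by blast
  then show "\<exists>\<sigma>. bij_betw \<sigma> B {0, 1} \<and> (n, transport2 B \<sigma> n f) \<in> Pi0 A F"
    using \<sigma> by blast
next
  fix xs \<sigma> assume xs: "xs \<in> tuples A n" "card (set xs) = 2" and \<sigma>: "\<sigma> \<in> klein_group A"
  obtain a b where ab: "set xs = {a, b}" "a \<noteq> b"
    using xs(2) by (auto simp: card_2_iff)
  then have "a \<in> A" "b \<in> A" "xs \<in> tuples {a, b} n"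
    using xs(1) by (auto simp: tuples_def)
  then show "\<sigma> (f xs) = f (map \<sigma> xs)"
    using op_on_pair_equivariant[OF f, of a b \<sigma> xs] sim_klein[OF sim \<sigma>, of a b] ab(2) by simp
qed

text \<open>Membership in \<open>Pi0\<close> supplies \<open>g\<close> on some other pair
  \<open>B'\<close> with its own coordinate \<open>\<sigma>'\<close>. A permutation carrying
  \<open>B\<close> to \<open>B'\<close> compatibly with both coordinates conjugates \<open>g\<close>
  into a member that acts on \<open>B\<close> as \<open>f\<close> does.\<close>

lemma klein_fun_agrees_on_pair:
  assumes klein: "klein_fun A (Pi0 A F) n f" and B: "B \<in> ksubsets A 2"
  obtains g where "(n, g) \<in> F" "\<forall>xs\<in>tuples B n. g xs = f xs"
proof -
  have f_B: "f xs \<in> B" if "xs \<in> tuples B n" for xs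
    using klein B that by (simp add: klein_fun_def)
  obtain \<sigma> where \<sigma>: "bij_betw \<sigma> B {0, 1}" "(n, transport2 B \<sigma> n f) \<in> Pi0 A F"
    using klein B unfolding klein_fun_def by blast
  then obtain g B' \<sigma>' where g: "(n, g) \<in> F" "B' \<in> ksubsets A 2" "bij_betw \<sigma>' B' {0, 1}"
      "transport2 B \<sigma> n f = transport2 B' \<sigma>' n g"
    unfolding Pi0_def by blast
  have BA: "B \<subseteq> A" "B' \<subseteq> A"
    using B g(2) by (auto simp: ksubsets_def)
  define r where "r x = inv_into B' \<sigma>' (\<sigma> x)" for x
  have r_bij: "bij_betw r B B'"
    using bij_betw_trans[OF \<sigma>(1) bij_betw_inv_into[OF g(3)]] by (simp add: r_def[abs_def] comp_def)
  obtain \<rho> where \<rho>: "\<rho> permutes A" "\<forall>x\<in>B. \<rho> x = r x"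
    using ex_permutes_extending[OF fin BA(1), of r] r_bij BA by (auto simp: bij_betw_def)
  obtain g' where g': "(n, g') \<in> F" "\<And>xs. xs \<in> tuples A n \<Longrightarrow> g (map \<rho> xs) = \<rho> (g' xs)"
    using conj_op_apply[OF g(1) \<rho>(1)] by blast
  have "g' xs = f xs" if xs: "xs \<in> tuples B n" for xs
  proof -
    have set_xs: "set xs \<subseteq> B" and xs_A: "xs \<in> tuples A n"
      using xs tuples_mono[OF BA(1)] by (auto simp: tuples_def)
    have "\<sigma> ` set xs \<subseteq> {0, 1}"
      using image_mono[OF set_xs, of \<sigma>] bij_betw_imp_surj_on[OF \<sigma>(1)] by simp
    then have ys: "map \<sigma> xs \<in> tuples {0, 1} n"
      using xs by (simp add: tuples_def)
    have map_inv: "map (inv_into B \<sigma>) (map \<sigma> xs) = xs"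
      unfolding map_map comp_def
      by (rule map_idI) (rule inv_into_f_f[OF bij_betw_imp_inj_on[OF \<sigma>(1)] subsetD[OF set_xs]])
    have map_inv2: "map (inv_into B' \<sigma>') (map \<sigma> xs) = map \<rho> xs"
      using \<rho>(2) set_xs by (auto simp: r_def)
    have "transport2 B \<sigma> n f (map \<sigma> xs) = transport2 B' \<sigma>' n g (map \<sigma> xs)"
      by (simp only: g(4))
    then have "\<sigma> (f xs) = \<sigma>' (g (map \<rho> xs))"
      unfolding transport2_def restrict_apply'[OF ys] map_inv map_inv2 .
    also have "\<dots> = \<sigma>' (\<rho> (g' xs))"
      by (simp only: g'(2)[OF xs_A])
    finally have eq: "\<sigma> (f xs) = \<sigma>' (\<rho> (g' xs))" .
    have g'_B: "g' xs \<in> B"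
      using cons_op[OF g'(1) xs_A] set_xs by blast
    then have "\<sigma> (g' xs) \<in> \<sigma>' ` B'"
      unfolding bij_betw_imp_surj_on[OF g(3)] bij_betw_imp_surj_on[OF \<sigma>(1), symmetric]
      by (rule imageI)
    then have eq': "\<sigma>' (\<rho> (g' xs)) = \<sigma> (g' xs)"
      using g'_B \<rho>(2) by (simp add: r_def f_inv_into_f)
    show ?thesis
      by (rule inj_onD[OF bij_betw_imp_inj_on[OF \<sigma>(1)] trans[OF eq eq', symmetric] g'_B f_B[OF xs]])
  qed
  then show ?thesis
    using that g'(1) by blast
qed

text \<open>Agreement on a pair passes to the complementary pair, because \<open>f\<close> and
  \<open>g\<close> both commute with a Klein involution exchanging the two.\<close>

lemma klein_fun_agrees_on_sim_pair:
  assumes klein: "klein_fun A (Pi0 A F) n f" and card: "card A = 4" and sim: "R2star A F = R_pm A"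
    and g: "(n, g) \<in> F" "\<forall>xs\<in>tuples {a, b} n. g xs = f xs"
    and xy: "(a, b) \<approx> (x, y)" and xs: "xs \<in> tuples A n" "set xs = {x, y}"
  shows "g xs = f xs"
proof -
  have mem: "a \<in> A" "b \<in> A" "x \<in> A" "y \<in> A" "a \<noteq> b" "x \<noteq> y"
    using sim_mem[OF xy] by auto
  have "{a, b} = {x, y} \<or> {a, b} \<inter> {x, y} = {}"
    using xy by (simp add: sim R_pm_def)
  then show ?thesis
  proof
    assume "{a, b} = {x, y}"
    then show ?thesis
      using g(2) xs by (auto simp: tuples_def)
  next
    assume disj: "{a, b} \<inter> {x, y} = {}"
    have "card {a, b, x, y} = card A"
      using mem disj by (auto simp: card card_insert_if)
    then have A: "A = {a, b, x, y}"
      using mem fin by (intro card_subset_eq[symmetric]) auto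
    define \<kappa> where "\<kappa> = transpose a x \<circ> transpose b y"
    have \<kappa>: "\<kappa> a = x" "\<kappa> x = a" "\<kappa> b = y" "\<kappa> y = b"
      using disj mem by (auto simp: \<kappa>_def transpose_def)
    have "\<kappa> permutes A"
      unfolding \<kappa>_def using mem by (intro permutes_compose permutes_swap_id)
    moreover have "\<forall>z\<in>A. \<kappa> z \<noteq> z \<and> \<kappa> (\<kappa> z) = z"
      unfolding A using \<kappa> disj by auto
    ultimately have \<kappa>_klein: "\<kappa> \<in> klein_group A"
      by (simp add: klein_group_def)
    have "map \<kappa> xs \<in> tuples {a, b} n"
      using xs \<kappa> by (auto simp: tuples_def)
    then have "g (map \<kappa> xs) = f (map \<kappa> xs)"
      using g(2) by blast
    moreover have "f (map \<kappa> xs) = \<kappa> (f xs)"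
      using klein xs \<kappa>_klein mem by (simp add: klein_fun_def)
    moreover have "g (map \<kappa> xs) = \<kappa> (g xs)"
    proof (rule op_on_pair_equivariant[OF g(1)])
      show "(x, y) \<approx> (\<kappa> x, \<kappa> y)"
        using sim_sym[OF xy] by (simp add: \<kappa>)
      show "xs \<in> tuples {x, y} n"
        using xs by (simp add: tuples_def)
    qed
    ultimately show ?thesis
      using permutes_inj[OF \<open>\<kappa> permutes A\<close>] by (simp add: inj_eq)
  qed
qed

text \<open>A value confined to \<open>{x, c}\<close> and to \<open>{x, d}\<close> must be
  \<open>x\<close>.\<close>

lemma klein_fun_small_range:
  assumes klein: "klein_fun A (Pi0 A F) n f" and card: "card A = 4"
    and xs: "xs \<in> tuples A n" "card (set xs) \<le> 1"
  obtains x where "set xs = {x}" "f xs = x"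
proof -
  have f_B: "f xs \<in> {c, d}" if "c \<in> A" "d \<in> A" "c \<noteq> d" "set xs \<subseteq> {c, d}" for c d
  proof -
    have "{c, d} \<in> ksubsets A 2"
      using that by (simp add: ksubsets_def)
    then show ?thesis
      using klein that xs(1) unfolding klein_fun_def by (auto simp: tuples_def)
  qed
  have "set xs = {} \<or> (\<exists>x. set xs = {x})"
    using xs(2) by (metis List.finite_set card_1_singletonE card_0_eq le_neq_implies_less less_one)
  then have "\<exists>x\<in>A. set xs \<subseteq> {x}"
  proof
    assume "set xs = {}"
    moreover have "A \<noteq> {}"
      using card by auto
    ultimately show ?thesis
      by auto
  next
    assume "\<exists>x. set xs = {x}"
    then show ?thesis
      using xs(1) by (auto simp: tuples_def)
  qed
  then obtain x where x: "x \<in> A" "set xs \<subseteq> {x}"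
    by blast
  have "card (A - {x}) = 3"
    using x card fin by simp
  then obtain c d e where cde: "A - {x} = {c, d, e}" "c \<noteq> d"
    by (auto simp: card_3_iff)
  then have "c \<in> A" "d \<in> A" "c \<noteq> x" "d \<noteq> x"
    by auto
  then have fx: "f xs = x"
    using f_B[of x c] f_B[of x d] x cde(2) by auto
  \<comment> \<open>The empty tuple also lies over \<open>{c, d}\<close>, which does not contain
    \<open>x\<close>; so there are no nullary Klein functions.\<close>
  have "set xs \<noteq> {}"
  proof
    assume "set xs = {}"
    then show False
      using f_B[of c d] fx \<open>c \<in> A\<close> \<open>d \<in> A\<close> \<open>c \<noteq> x\<close> \<open>d \<noteq> x\<close> cde(2) by auto
  qed
  then have "set xs = {x}"
    using x(2) by (auto simp: subset_singleton_iff)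
  then show ?thesis
    using that fx by blast
qed

lemma klein_fun_agrees:
  assumes klein: "klein_fun A (Pi0 A F) n f" and card: "card A = 4" and sim: "R2star A F = R_pm A"
  obtains g where "(n, g) \<in> F"
    "\<And>xs. xs \<in> tuples A n \<Longrightarrow> card (set xs) \<le> 2 \<Longrightarrow> g xs = f xs"
proof -
  obtain a b c d where A: "A = {a, b, c, d}" and dist: "distinct [a, b, c, d]"
  proof -
    obtain xs where xs: "set xs = A" "distinct xs"
      using finite_distinct_list[OF fin] by blast
    then have "length xs = 4"
      using card distinct_card by metis
    then obtain a b c d where "xs = [a, b, c, d]"
      by (auto simp: length_Suc_conv numeral_eq_Suc)
    then show ?thesis
      using that xs by auto
  qed
  \<comment> \<open>The three partitions of \<open>A\<close> into pairs are indexed by the partner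
    of \<open>a\<close>.\<close>
  have two: "{a, y} \<in> ksubsets A 2" if "y \<in> {b, c, d}" for y
    using that dist by (auto simp: ksubsets_def A)
  obtain g1 where g1: "(n, g1) \<in> F" "\<forall>xs\<in>tuples {a, b} n. g1 xs = f xs"
    using klein_fun_agrees_on_pair[OF klein two[of b]] by blast
  obtain g2 where g2: "(n, g2) \<in> F" "\<forall>xs\<in>tuples {a, c} n. g2 xs = f xs"
    using klein_fun_agrees_on_pair[OF klein two[of c]] by blast
  obtain g3 where g3: "(n, g3) \<in> F" "\<forall>xs\<in>tuples {a, d} n. g3 xs = f xs"
    using klein_fun_agrees_on_pair[OF klein two[of d]] by blast
  have sel: "\<exists>t. (2, t) \<in> F \<and> (\<forall>x\<in>A. \<forall>y\<in>A. t [x, y] = (if z \<approx> (x, y) then x else y))" for z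
  proof -
    have "\<And>x y. x \<approx> y \<Longrightarrow> x \<in> {x. z \<approx> x} \<Longrightarrow> y \<in> {x. z \<approx> x}"
      using sim_trans by blast
    then obtain t where "(2, t) \<in> F"
        "\<And>x y. x \<in> A \<Longrightarrow> y \<in> A \<Longrightarrow> t [x, y] = (if (x, y) \<in> {x. z \<approx> x} then x else y)"
      using selector[of "{x. z \<approx> x}"] by blast
    then show ?thesis
      by auto
  qed
  obtain t1 where t1: "(2, t1) \<in> F"
      "\<forall>x\<in>A. \<forall>y\<in>A. t1 [x, y] = (if (a, b) \<approx> (x, y) then x else y)"
    using sel by blast
  obtain t2 where t2: "(2, t2) \<in> F"
      "\<forall>x\<in>A. \<forall>y\<in>A. t2 [x, y] = (if (a, c) \<approx> (x, y) then x else y)"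
    using sel by blast
  obtain g23 where g23: "(n, g23) \<in> F" "\<And>xs. xs \<in> tuples A n \<Longrightarrow> g23 xs = t2 [g2 xs, g3 xs]"
    using comp_binary[OF t2(1) g2(1) g3(1)] by blast
  obtain g where g: "(n, g) \<in> F" "\<And>xs. xs \<in> tuples A n \<Longrightarrow> g xs = t1 [g1 xs, g23 xs]"
    using comp_binary[OF t1(1) g1(1) g23(1)] by blast
  have "g xs = f xs" if xs: "xs \<in> tuples A n" "card (set xs) \<le> 2" for xs
  proof (cases "card (set xs) = 2")
    case False
    then have "card (set xs) \<le> 1"
      using xs(2) by linarith
    then obtain x where "set xs = {x}" "f xs = x"
      using klein_fun_small_range[OF klein card xs(1)] by blast
    then show ?thesis
      using cons_op[OF g(1) xs(1)] by simp
  next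
    case True
    then obtain x y where set_xs: "set xs = {x, y}" "x \<noteq> y"
      by (auto simp: card_2_iff)
    have xy: "x \<in> A" "y \<in> A"
      using xs(1) set_xs by (auto simp: tuples_def)
    have mem: "g1 xs \<in> {x, y}" "g2 xs \<in> {x, y}" "g3 xs \<in> {x, y}" "g23 xs \<in> {x, y}"
      using cons_op[OF g1(1) xs(1)] cons_op[OF g2(1) xs(1)] cons_op[OF g3(1) xs(1)]
        cons_op[OF g23(1) xs(1)] set_xs by auto
    \<comment> \<open>Under \<open>R_pm\<close> reversed pairs are related, so a selector's decision
      depends only on the set of entries, not on which of them \<open>g1\<close>, \<open>g2\<close>
      and \<open>g3\<close> return.\<close>
    have sim_iff: "z \<approx> (u, v) \<longleftrightarrow> z \<approx> (x, y)" if "u \<in> {x, y}" "v \<in> {x, y}" "u \<noteq> v" for z u v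
    proof -
      have "(x, y) \<approx> (u, v)"
        using that xy set_xs(2) by (auto simp: sim R_pm_def A22_iff)
      then show ?thesis
        using sim_trans sim_sym by blast
    qed
    have t1_eq: "t1 [u, v] = (if (a, b) \<approx> (x, y) then u else v)"
      if "u \<in> {x, y}" "v \<in> {x, y}" for u v
      using t1(2) that xy sim_iff[OF that] by (cases "u = v") auto
    have t2_eq: "t2 [u, v] = (if (a, c) \<approx> (x, y) then u else v)"
      if "u \<in> {x, y}" "v \<in> {x, y}" for u v
      using t2(2) that xy sim_iff[OF that] by (cases "u = v") auto
    have g_eq: "g xs = (if (a, b) \<approx> (x, y) then g1 xs else if (a, c) \<approx> (x, y) then g2 xs else g3 xs)"
      using g(2)[OF xs(1)] g23(2)[OF xs(1)] t1_eq[OF mem(1,4)] t2_eq[OF mem(2,3)] by simp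
    have "(a, b) \<approx> (x, y) \<or> (a, c) \<approx> (x, y) \<or> (a, d) \<approx> (x, y)"
      using xy set_xs(2) dist unfolding sim by (auto simp: R_pm_def A22_def A)
    then show ?thesis
      using g_eq klein_fun_agrees_on_sim_pair[OF klein card sim g1 _ xs(1) set_xs(1)]
        klein_fun_agrees_on_sim_pair[OF klein card sim g2 _ xs(1) set_xs(1)]
        klein_fun_agrees_on_sim_pair[OF klein card sim g3 _ xs(1) set_xs(1)] by presburger
  qed
  then show ?thesis
    using that g(1) by blast
qed

text \<open>At a coordinate of \<open>Q3 Q H\<close> an argument tuple has at most two distinct
  entries, so one member of the clone replaces \<open>f\<close> at all these coordinates
  simultaneously.\<close>

lemma klein_fun_preserves:
  assumes inv: "H \<in> Inv A Q F" and card: "card A = 4" and sim: "R2star A F = R_pm A"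
    and klein: "klein_fun A (Pi0 A F) n f"
  shows "preserves (Q3 Q H) n f (restr H (Q3 Q H))"
  unfolding preserves_restr_iff
proof (intro allI impI)
  fix hs assume hs: "length hs = n" "set hs \<subseteq> H"
  have H: "H \<subseteq> Q \<rightarrow>\<^sub>E A"
    using inv by (simp add: Inv_def)
  obtain g where g: "(n, g) \<in> F"
      "\<And>xs. xs \<in> tuples A n \<Longrightarrow> card (set xs) \<le> 2 \<Longrightarrow> g xs = f xs"
    using klein_fun_agrees[OF klein card sim] by blast
  have "agrees_on H (\<lambda>q. g (map (\<lambda>h. h q) hs)) Q"
    using inv g(1) hs unfolding in_Inv_iff[OF H] closed_on_def by blast
  then have "agrees_on H (\<lambda>q. g (map (\<lambda>h. h q) hs)) (Q3 Q H)"
    by (rule agrees_on_mono) (auto simp: Q3_def)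
  moreover have "g (map (\<lambda>h. h q) hs) = f (map (\<lambda>h. h q) hs)" if q: "q \<in> Q3 Q H" for q
  proof (rule g(2))
    have "q \<in> Q"
      using q by (simp add: Q3_def)
    then have Hq_A: "Hq H q \<subseteq> A"
      unfolding Hq_def using PiE_mem[OF subsetD[OF H]] by blast
    have sub: "set (map (\<lambda>h. h q) hs) \<subseteq> Hq H q"
      using hs(2) by (auto simp: Hq_def)
    then show "map (\<lambda>h. h q) hs \<in> tuples A n"
      using Hq_A hs(1) unfolding tuples_def by simp
    have "card (set (map (\<lambda>h. h q) hs)) \<le> card (Hq H q)"
      by (rule card_mono[OF finite_subset[OF Hq_A fin] sub])
    then show "card (set (map (\<lambda>h. h q) hs)) \<le> 2"
      using q by (simp add: Q3_def)
  qed
  ultimately show "agrees_on H (\<lambda>q. f (map (\<lambda>h. h q) hs)) (Q3 Q H)"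
    by (simp add: agrees_on_def)
qed

end

section \<open>The three characterizations of invariance\<close>

theorem theorem4:
  fixes A :: "'a set" and Q :: "'q set" and H :: "('q \<Rightarrow> 'a) set"
    and F :: "(nat \<times> ('a list \<Rightarrow> 'a)) set"
  assumes "finite A" and "card A \<ge> 2"
    and "finite Q" and "Q \<noteq> {}"
    and "finite H" and "H \<noteq> {}" and "H \<subseteq> Q \<rightarrow>\<^sub>E A"
    and "clone A F" and "conservative A F" and "symmetric_ops A F"
    and "clone_rank A F = 2"
  shows
    "(\<not> (card A = 4 \<and> R2star A F = R_pm A) \<and> \<not> (card A = 3 \<and> R2star A F = R_up A) \<longrightarrow>
       (H \<in> Inv A Q F \<longleftrightarrow>
          (\<forall>B \<in> ksubsets A 2. restr H (QB Q H B) \<in> Inv B (QB Q H B) (restrict_ops B F))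
          \<and> decomposable A Q H (singletons Q \<union> pairs_id Q H \<union> {QB Q H B | B. B \<in> ksubsets A 2})))
     \<and> (card A = 4 \<and> R2star A F = R_pm A \<longrightarrow>
       (H \<in> Inv A Q F \<longleftrightarrow>
          (\<forall>P \<in> pairs0 A Q H. restr H P \<in> Inv A P F)
          \<and> (\<forall>n f. klein_fun A (Pi0 A F) n f \<longrightarrow> preserves (Q3 Q H) n f (restr H (Q3 Q H)))
          \<and> decomposable A Q H (singletons Q \<union> pairs0 A Q H \<union> {Q3 Q H})))
     \<and> (card A = 3 \<and> R2star A F = R_up A \<longrightarrow>
       (H \<in> Inv A Q F \<longleftrightarrow>
          (\<forall>P \<in> pairs0 A Q H \<union> pairs1 A Q H. restr H P \<in> Inv A P F)
          \<and> decomposable A Q H (singletons Q \<union> pairs0 A Q H \<union> pairs1 A Q H)))"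
proof -
  note H = \<open>H \<subseteq> Q \<rightarrow>\<^sub>E A\<close>
  interpret sym_cons_clone A F
    by standard (rule assms)+
  have singles: "R \<subseteq> Q \<and> closed_on F H R" if "R \<in> singletons Q" for R
    using that closed_on_singleton[OF H] by (auto simp: singletons_def)
  have pairs_id: "R \<subseteq> Q \<and> closed_on F H R" if "R \<in> pairs_id Q H" for R
    using that closed_on_pairs_id[OF H that] by (auto simp: pairs_id_def)
  have pairs_sub: "R \<subseteq> Q" if "R \<in> pairs0 A Q H \<union> pairs1 A Q H" for R
    using that by (auto simp: pairs0_def pairs1_def)
  have pairs: "R \<subseteq> Q \<and> closed_on F H R"
    if "R \<in> pairs0 A Q H \<union> pairs1 A Q H" "restr H R \<in> Inv A R F" for R
    using pairs_sub[OF that(1)] that(2) restr_in_Inv_iff[OF H] by blast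
  have QB: "QB Q H B \<subseteq> Q \<and> closed_on F H (QB Q H B)"
    if "restr H (QB Q H B) \<in> Inv B (QB Q H B) (restrict_ops B F)" for B
    by (rule conjI[OF QB_subset restr_QB_in_Inv_iff[THEN iffD1, OF that]])
  have ne: "singletons Q \<noteq> {}"
    using \<open>Q \<noteq> {}\<close> by (auto simp: singletons_def)
  have closed: "closed_on F H R" if "H \<in> Inv A Q F" "R \<subseteq> Q" for R
    using that closed_on_mono unfolding in_Inv_iff[OF H] by blast
  have nt: "\<not> sim_total"
    by (rule not_sim_total[OF \<open>clone_rank A F = 2\<close>])
  show ?thesis
  proof (intro conjI impI iffI ballI allI)
    fix B assume "H \<in> Inv A Q F"
    then show "restr H (QB Q H B) \<in> Inv B (QB Q H B) (restrict_ops B F)"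
      using closed[OF _ QB_subset] by (simp add: restr_QB_in_Inv_iff)
  next
    assume *: "\<not> (card A = 4 \<and> R2star A F = R_pm A) \<and> \<not> (card A = 3 \<and> R2star A F = R_up A)"
      and inv: "H \<in> Inv A Q F"
    show "decomposable A Q H (singletons Q \<union> pairs_id Q H \<union> {QB Q H B | B. B \<in> ksubsets A 2})"
      by (rule decomposable_generic[OF inv \<open>finite Q\<close> \<open>Q \<noteq> {}\<close> \<open>H \<noteq> {}\<close> sim_cases[OF nt]])
        (use * in auto)
  next
    assume *: "(\<forall>B \<in> ksubsets A 2. restr H (QB Q H B) \<in> Inv B (QB Q H B) (restrict_ops B F))
      \<and> decomposable A Q H (singletons Q \<union> pairs_id Q H \<union> {QB Q H B | B. B \<in> ksubsets A 2})"
    show "H \<in> Inv A Q F"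
    proof (rule Inv_if_decomposable[OF H])
      fix R assume "R \<in> singletons Q \<union> pairs_id Q H \<union> {QB Q H B | B. B \<in> ksubsets A 2}"
      then show "R \<subseteq> Q \<and> closed_on F H R"
        using singles[of R] pairs_id[of R] QB * by blast
    qed (use * ne in auto)
  next
    fix P assume "H \<in> Inv A Q F" "P \<in> pairs0 A Q H"
    then show "restr H P \<in> Inv A P F"
      using closed[of P] pairs_sub[of P] by (simp add: restr_in_Inv_iff[OF H])
  next
    fix n f assume "card A = 4 \<and> R2star A F = R_pm A" "H \<in> Inv A Q F" "klein_fun A (Pi0 A F) n f"
    then show "preserves (Q3 Q H) n f (restr H (Q3 Q H))"
      using klein_fun_preserves by blast
  next
    assume "card A = 4 \<and> R2star A F = R_pm A" "H \<in> Inv A Q F"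
    then show "decomposable A Q H (singletons Q \<union> pairs0 A Q H \<union> {Q3 Q H})"
      using decomposable_R_pm[OF _ \<open>finite Q\<close> \<open>Q \<noteq> {}\<close> \<open>H \<noteq> {}\<close>] by blast
  next
    assume pm: "card A = 4 \<and> R2star A F = R_pm A"
      and *: "(\<forall>P \<in> pairs0 A Q H. restr H P \<in> Inv A P F)
        \<and> (\<forall>n f. klein_fun A (Pi0 A F) n f \<longrightarrow> preserves (Q3 Q H) n f (restr H (Q3 Q H)))
        \<and> decomposable A Q H (singletons Q \<union> pairs0 A Q H \<union> {Q3 Q H})"
    \<comment> \<open>Members of \<open>F\<close> are themselves Klein functions, so preservation by
      all Klein functions includes closure under \<open>F\<close> on this block.\<close>
    have "preserves (Q3 Q H) n f (restr H (Q3 Q H))" if "(n, f) \<in> F" for n f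
      using * op_klein_fun[OF _ that] pm by blast
    then have Q3: "Q3 Q H \<subseteq> Q \<and> closed_on F H (Q3 Q H)"
      unfolding closed_on_def preserves_restr_iff by (auto simp: Q3_def)
    show "H \<in> Inv A Q F"
    proof (rule Inv_if_decomposable[OF H])
      fix R assume "R \<in> singletons Q \<union> pairs0 A Q H \<union> {Q3 Q H}"
      then show "R \<subseteq> Q \<and> closed_on F H R"
        using singles[of R] pairs[of R] * Q3 by blast
    qed (use * ne in auto)
  next
    fix P assume "H \<in> Inv A Q F" "P \<in> pairs0 A Q H \<union> pairs1 A Q H"
    then show "restr H P \<in> Inv A P F"
      using closed[of P] pairs_sub[of P] by (simp add: restr_in_Inv_iff[OF H])
  next
    assume "card A = 3 \<and> R2star A F = R_up A" "H \<in> Inv A Q F"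
    then show "decomposable A Q H (singletons Q \<union> pairs0 A Q H \<union> pairs1 A Q H)"
      using decomposable_R_up[OF _ \<open>finite Q\<close> \<open>Q \<noteq> {}\<close> \<open>H \<noteq> {}\<close>] by blast
  next
    assume *: "(\<forall>P \<in> pairs0 A Q H \<union> pairs1 A Q H. restr H P \<in> Inv A P F)
      \<and> decomposable A Q H (singletons Q \<union> pairs0 A Q H \<union> pairs1 A Q H)"
    show "H \<in> Inv A Q F"
    proof (rule Inv_if_decomposable[OF H])
      fix R assume "R \<in> singletons Q \<union> pairs0 A Q H \<union> pairs1 A Q H"
      then show "R \<subseteq> Q \<and> closed_on F H R"
        using singles[of R] pairs[of R] * by blast
    qed (use * ne in auto)
  qed
qed

end
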